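(* Assume $s\ge\frac{N(p-1)+p+pa}{N-p}$ and $m\ge\frac{N(q-1)+q+qb}{N-q}$. Then all the regular radial solutions of the system $$-\Delta_p u=|x|^a u^s v^\delta,\qquad -\Delta_q v=|x|^b u^\mu v^m$$ are ground states (G.S.).
   Context: Here $N$ is the space dimension, $\Delta_p u=\operatorname{div}(|\nabla u|^{p-2}\nabla u)$, and the parameters are real numbers with $1<p,q<N$, $\min(p+a,q+b)>0$, $s,m\ge 0$, $\delta,\mu>0$ and $D=\delta\mu-(p-1-s)(q-1-m)>0$. Radial positive solutions $r=|x|\mapsto(u(r),v(r))$ satisfy $$-r^{1-N}\big(r^{N-1}|u'|^{p-2}u'\big)'=r^a u^s v^\delta,\qquad -r^{1-N}\big(r^{N-1}|v'|^{q-2}v'\big)'=r^b u^\mu v^m .$$ A positive solution $(u,v)$ on $(0,R)$ is regular (at $0$) if $u,v\in C^2(0,R)\cap C([0,R))$. Regular radial solutions are considered on their maximal interval $(0,R)$, $R\le\infty$, of existence as positive solutions. A ground state (G.S.) is a solution $(u,v)$, positive on the whole of $(0,\infty)$, and regular at $0$. ("Trivial" solutions $(0,C)$, $(C,0)$ with $C$ constant are excluded.) *)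

theory Defs
  imports "HOL-Analysis.Analysis"
begin

definition has_divergence ::
    "('a::euclidean_space \<Rightarrow> 'a) \<Rightarrow> real \<Rightarrow> 'a \<Rightarrow> bool" where
  "has_divergence F d x \<longleftrightarrow>
     (\<exists>F'. (F has_derivative F') (at x) \<and> d = (\<Sum>e\<in>Basis. F' e \<bullet> e))"

(* At a zero of the gradient the flux is 0 for every p > 1, also when p < 2:
   0 powr (p - 2) = 0 and it multiplies the zero vector. *)
definition has_p_laplacian ::
    "real \<Rightarrow> ('a::euclidean_space \<Rightarrow> real) \<Rightarrow> real \<Rightarrow> 'a \<Rightarrow> bool" where
  "has_p_laplacian p f L x \<longleftrightarrow>
     (\<exists>g. (\<forall>\<^sub>F y in nhds x. GDERIV f y :> g y) \<and>
          has_divergence (\<lambda>y. norm (g y) powr (p - 2) *\<^sub>R g y) L x)"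

definition C2_on :: "real set \<Rightarrow> (real \<Rightarrow> real) \<Rightarrow> bool" where
  "C2_on S f \<longleftrightarrow>
     (\<exists>f' f''. (\<forall>r\<in>S. (f has_real_derivative f' r) (at r) \<and>
                       (f' has_real_derivative f'' r) (at r)) \<and>
               continuous_on S f'')"

(* The pair (u, v) consists of the radial profiles: the functions solving the system are
   x \<mapsto> u (norm x) and x \<mapsto> v (norm x) on the punctured ball of radius R in the Euclidean
   space 'a. Values of u and v outside [0, R) are irrelevant. *)
definition positive_radial_solution ::
    "'a::euclidean_space itself \<Rightarrow> real \<Rightarrow> real \<Rightarrow> real \<Rightarrow> real \<Rightarrow> real \<Rightarrow> real \<Rightarrow> real \<Rightarrow> real
      \<Rightarrow> ereal \<Rightarrow> (real \<Rightarrow> real) \<Rightarrow> (real \<Rightarrow> real) \<Rightarrow> bool" where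
  "positive_radial_solution (E::'a itself) p q a b s m \<delta> \<mu> R u v \<longleftrightarrow>
     (\<forall>r>0. ereal r < R \<longrightarrow> u r > 0 \<and> v r > 0) \<and>
     (\<forall>x::'a. x \<noteq> 0 \<and> ereal (norm x) < R \<longrightarrow>
        has_p_laplacian p (\<lambda>y. u (norm y))
          (- (norm x powr a * u (norm x) powr s * v (norm x) powr \<delta>)) x \<and>
        has_p_laplacian q (\<lambda>y. v (norm y))
          (- (norm x powr b * u (norm x) powr \<mu> * v (norm x) powr m)) x)"

definition regular_radial_solution ::
    "'a::euclidean_space itself \<Rightarrow> real \<Rightarrow> real \<Rightarrow> real \<Rightarrow> real \<Rightarrow> real \<Rightarrow> real \<Rightarrow> real \<Rightarrow> real
      \<Rightarrow> ereal \<Rightarrow> (real \<Rightarrow> real) \<Rightarrow> (real \<Rightarrow> real) \<Rightarrow> bool" where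
  "regular_radial_solution E p q a b s m \<delta> \<mu> R u v \<longleftrightarrow>
     0 < R \<and> positive_radial_solution E p q a b s m \<delta> \<mu> R u v \<and>
     C2_on {r. 0 < r \<and> ereal r < R} u \<and> C2_on {r. 0 < r \<and> ereal r < R} v \<and>
     continuous_on {r. 0 \<le> r \<and> ereal r < R} u \<and>
     continuous_on {r. 0 \<le> r \<and> ereal r < R} v"

definition maximal_regular_radial_solution ::
    "'a::euclidean_space itself \<Rightarrow> real \<Rightarrow> real \<Rightarrow> real \<Rightarrow> real \<Rightarrow> real \<Rightarrow> real \<Rightarrow> real \<Rightarrow> real
      \<Rightarrow> ereal \<Rightarrow> (real \<Rightarrow> real) \<Rightarrow> (real \<Rightarrow> real) \<Rightarrow> bool" where
  "maximal_regular_radial_solution E p q a b s m \<delta> \<mu> R u v \<longleftrightarrow>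
     regular_radial_solution E p q a b s m \<delta> \<mu> R u v \<and>
     \<not> (\<exists>R' u1 v1. R < R' \<and> regular_radial_solution E p q a b s m \<delta> \<mu> R' u1 v1 \<and>
          (\<forall>r\<ge>0. ereal r < R \<longrightarrow> u1 r = u r \<and> v1 r = v r))"

definition ground_state ::
    "'a::euclidean_space itself \<Rightarrow> real \<Rightarrow> real \<Rightarrow> real \<Rightarrow> real \<Rightarrow> real \<Rightarrow> real \<Rightarrow> real \<Rightarrow> real
      \<Rightarrow> (real \<Rightarrow> real) \<Rightarrow> (real \<Rightarrow> real) \<Rightarrow> bool" where
  "ground_state E p q a b s m \<delta> \<mu> u v \<longleftrightarrow>
     regular_radial_solution E p q a b s m \<delta> \<mu> \<infinity> u v"

end

theory Submission
  imports Defs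
begin

text \<open>
  A solution can fail to be global only if one of its components reaches zero at a finite
  radius, and the lower bounds on \<open>s\<close> and \<open>m\<close> rule this out for each component separately,
  by a Pohozaev argument in which the other component enters only through its monotonicity.

  Write \<open>V = v\<^sup>\<delta>\<close>, \<open>W = - u'\<close> and let \<open>F = r\<^bsup>N-1\<^esup> W\<^bsup>p-1\<^esup>\<close> be the inward flux. The system says that
  \<open>F' = r\<^bsup>N-1+a\<^esup> u\<^sup>s V > 0\<close>. Continuity of \<open>u\<close> at the origin forces \<open>F > 0\<close>, \<open>F \<longlongrightarrow> 0\<close> and
  \<open>r W \<longlongrightarrow> 0\<close> there (\<open>flux_positive\<close>, \<open>radius_times_slope_tendsto_0\<close>): a flux that stays away
  from zero makes \<open>u\<close> as singular as the fundamental solution, whose increments over dyadic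
  intervals do not tend to zero. In particular both \<open>u\<close> and \<open>v\<close> decrease. The energy
  \<open>E = (p-1)/p r F W + r\<^bsup>N+a\<^esup> u\<^bsup>s+1\<^esup> V / (s+1) - (N-p)/p F u\<close> then vanishes at the origin and satisfies
  \<open>E' = ((N+a)/(s+1) - (N-p)/p) u F' + r\<^bsup>N+a\<^esup> u\<^bsup>s+1\<^esup> V' / (s+1) < 0\<close>, because the hypothesis on \<open>s\<close>
  says exactly that the first bracket is nonpositive, and \<open>V' < 0\<close>. Hence \<open>F u\<close> is bounded
  below by a positive constant away from the origin. As \<open>F\<close> is bounded on bounded intervals, so is
  \<open>u\<close> (\<open>pohozaev_lower_bound\<close>); exchanging the roles of the two equations treats \<open>v\<close>.

  If the maximal radius \<open>\<rho>\<close> were finite, then \<open>u\<close>, \<open>v\<close> and both fluxes would have positive limits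
  at \<open>\<rho>\<close>. At such a point the first-order system for the two components and the two fluxes is
  locally Lipschitz, so a Picard solution starting at these limits continues the given one beyond
  \<open>\<rho>\<close> (\<open>radial_system_continuation\<close>), contradicting maximality.

  The passage between the equation on the punctured ball and the radial equation is
  \<open>has_p_laplacian_radial_iff\<close>.
\<close>

section \<open>The p-Laplacian of a radial function\<close>

text \<open>
  The flux field of a radial function is \<open>\<psi>(|y|) y / |y|\<close>, whose divergence is
  \<open>\<psi>' + (n - 1) \<psi> / r\<close>. Conversely, differentiability of the field gives that of \<open>\<psi>\<close> by
  restriction to the ray through \<open>x\<close>. No second derivative of \<open>f\<close> is involved, so the
  equivalence also covers degenerate points, where only the flux is differentiable.
\<close>

lemma has_p_laplacian_radial_iff:
  fixes x :: "'a::euclidean_space" and f w :: "real \<Rightarrow> real" and p L :: real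
  assumes x: "x \<noteq> 0" and D: "\<forall>\<^sub>F r in nhds (norm x). (f has_real_derivative w r) (at r)"
  defines "\<psi> \<equiv> \<lambda>r. \<bar>w r\<bar> powr (p - 2) * w r"
  shows "has_p_laplacian p (\<lambda>y::'a. f (norm y)) L x \<longleftrightarrow>
    (\<psi> has_real_derivative (L - (real DIM('a) - 1) / norm x * \<psi> (norm x))) (at (norm x))"
proof -
  let ?r = "norm x"
  have r: "?r > 0" using x by simp
  define G where "G = (\<lambda>y::'a. (\<psi> (norm y) / norm y) *\<^sub>R y)"
  have tn: "filterlim norm (nhds ?r) (nhds x)"
    by (intro tendsto_norm filterlim_ident)
  have nz: "\<forall>\<^sub>F y::'a in nhds x. y \<noteq> 0"
    using x by (intro t1_space_nhds)
  have evD: "\<forall>\<^sub>F y::'a in nhds x. (f has_real_derivative w (norm y)) (at (norm y))"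
    using D tn by (rule eventually_compose_filterlim)
  have grad: "\<forall>\<^sub>F y::'a in nhds x. GDERIV (\<lambda>y. f (norm y)) y :> w (norm y) *\<^sub>R sgn y"
    using nz evD
  proof eventually_elim
    case (elim y)
    then show ?case by (intro GDERIV_DERIV_compose GDERIV_norm) auto
  qed
  have Gflux: "\<forall>\<^sub>F y in nhds x. norm (g y) powr (p - 2) *\<^sub>R g y = G y"
    if g: "\<forall>\<^sub>F y::'a in nhds x. GDERIV (\<lambda>y. f (norm y)) y :> g y" for g
    using g grad nz
  proof eventually_elim
    case (elim y)
    have "(\<lambda>h. h \<bullet> g y) = (\<lambda>h. h \<bullet> (w (norm y) *\<^sub>R sgn y))"
      using elim unfolding gderiv_def by (blast intro: has_derivative_unique)
    then have "g y = w (norm y) *\<^sub>R sgn y"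
      by (metis vector_eq_ldot)
    moreover from this have "norm (g y) = \<bar>w (norm y)\<bar>"
      using elim(3) by (simp add: norm_sgn)
    ultimately show ?case
      using elim(3) by (simp add: G_def \<psi>_def norm_sgn sgn_div_norm divide_inverse)
  qed
  have div_cong: "has_divergence F L x \<longleftrightarrow> has_divergence G L x"
    if "\<forall>\<^sub>F y in nhds x. F y = G y" for F
  proof -
    have "has_divergence F2 L x"
      if "has_divergence F1 L x" and ev: "\<forall>\<^sub>F y in nhds x. F1 y = F2 y" for F1 F2 :: "'a \<Rightarrow> 'a"
      using that(1) unfolding has_divergence_def
      using has_derivative_transform_eventually[of F1 _ x UNIV F2]
        eventually_nhds_x_imp_x[OF ev] ev eventually_nhds_conv_at by blast
    from this[of F G] this[of G F] show ?thesis using that by (auto simp: eq_commute)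
  qed
  have "has_p_laplacian p (\<lambda>y::'a. f (norm y)) L x \<longleftrightarrow> has_divergence G L x"
  proof
    assume "has_p_laplacian p (\<lambda>y::'a. f (norm y)) L x"
    then obtain g where g: "\<forall>\<^sub>F y in nhds x. GDERIV (\<lambda>y. f (norm y)) y :> g y"
      and dv: "has_divergence (\<lambda>y. norm (g y) powr (p - 2) *\<^sub>R g y) L x"
      unfolding has_p_laplacian_def by blast
    show "has_divergence G L x"
      using div_cong[OF Gflux[OF g]] dv by blast
  next
    assume "has_divergence G L x"
    then show "has_p_laplacian p (\<lambda>y::'a. f (norm y)) L x"
      unfolding has_p_laplacian_def using div_cong[OF Gflux[OF grad]] grad
      by (intro exI[of _ "\<lambda>y. w (norm y) *\<^sub>R sgn y"]) blast
  qed
  also have "\<dots> \<longleftrightarrow>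
    (\<psi> has_real_derivative (L - (real DIM('a) - 1) / ?r * \<psi> ?r)) (at ?r)"
  proof -
    have fwd: "has_divergence G (d + (real DIM('a) - 1) / ?r * \<psi> ?r) x \<and>
               (\<forall>L. has_divergence G L x \<longrightarrow> L = d + (real DIM('a) - 1) / ?r * \<psi> ?r)"
      if d: "(\<psi> has_real_derivative d) (at ?r)" for d
    proof -
      define k' where "k' = (d * ?r - \<psi> ?r) / ?r\<^sup>2"
      have k: "((\<lambda>t. \<psi> t / t) has_real_derivative k') (at ?r)"
        unfolding k'_def using r d by (auto intro!: derivative_eq_intros simp: power2_eq_square)
      have "GDERIV (\<lambda>y. \<psi> (norm y) / norm y) x :> k' *\<^sub>R sgn x"
        by (rule GDERIV_DERIV_compose[OF GDERIV_norm[OF x] k])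
      then have "((\<lambda>y. \<psi> (norm y) / norm y) has_derivative (\<lambda>h. h \<bullet> (k' *\<^sub>R sgn x))) (at x)"
        by (simp add: gderiv_def)
      from has_derivative_scaleR[OF this has_derivative_ident]
      have dG: "(G has_derivative (\<lambda>h. (\<psi> ?r / ?r) *\<^sub>R h + (h \<bullet> (k' *\<^sub>R sgn x)) *\<^sub>R x)) (at x)"
        unfolding G_def by simp
      have "(\<Sum>e\<in>Basis. ((\<psi> ?r / ?r) *\<^sub>R e + (e \<bullet> (k' *\<^sub>R sgn x)) *\<^sub>R x) \<bullet> e)
          = (\<Sum>e\<in>(Basis::'a set). \<psi> ?r / ?r + k' / ?r * ((x \<bullet> e) * (x \<bullet> e)))"
        by (intro sum.cong)
           (simp_all add: inner_add_left sgn_div_norm inner_commute[of _ x] divide_inverse algebra_simps)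
      also have "\<dots> = real DIM('a) * (\<psi> ?r / ?r) + k' / ?r * (x \<bullet> x)"
        by (simp add: sum.distrib sum_distrib_left euclidean_inner[of x x] sum_divide_distrib)
      also have "\<dots> = d + (real DIM('a) - 1) / ?r * \<psi> ?r"
        using r by (simp add: k'_def power2_norm_eq_inner[symmetric] power2_eq_square field_simps)
      finally have tr: "(\<Sum>e\<in>Basis. ((\<psi> ?r / ?r) *\<^sub>R e + (e \<bullet> (k' *\<^sub>R sgn x)) *\<^sub>R x) \<bullet> e)
          = d + (real DIM('a) - 1) / ?r * \<psi> ?r" .
      have "L = d + (real DIM('a) - 1) / ?r * \<psi> ?r" if dv: "has_divergence G L x" for L
      proof -
        obtain F' where F': "(G has_derivative F') (at x)" "L = (\<Sum>e\<in>Basis. F' e \<bullet> e)"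
          using dv unfolding has_divergence_def by blast
        then show ?thesis using has_derivative_unique[OF F'(1) dG] tr by simp
      qed
      then show ?thesis
        unfolding has_divergence_def using dG tr by (metis (no_types, lifting))
    qed
    have bwd: "\<exists>d. (\<psi> has_real_derivative d) (at ?r)" if dv: "has_divergence G L x"
    proof -
      obtain F' where F': "(G has_derivative F') (at x)"
        using dv unfolding has_divergence_def by blast
      define e where "e = sgn x"
      have e: "norm e = 1" "?r *\<^sub>R e = x"
        using x by (simp_all add: e_def norm_sgn sgn_div_norm)
      then have ee: "e \<bullet> e = 1" by (simp add: norm_eq_1)
      have "((\<lambda>t. G (t *\<^sub>R e)) has_derivative (\<lambda>h. F' (h *\<^sub>R e))) (at ?r)"
        by (rule has_derivative_compose[of "\<lambda>t. t *\<^sub>R e" "\<lambda>h. h *\<^sub>R e" ?r UNIV G F'])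
           (use F' e in \<open>auto intro!: derivative_eq_intros\<close>)
      then have "((\<lambda>t. G (t *\<^sub>R e) \<bullet> e) has_derivative (\<lambda>h. F' (h *\<^sub>R e) \<bullet> e)) (at ?r)"
        by (auto intro!: derivative_eq_intros)
      then have "((\<lambda>t. G (t *\<^sub>R e) \<bullet> e) has_real_derivative (F' e \<bullet> e)) (at ?r)"
        unfolding has_field_derivative_def
        by (rule has_derivative_eq_rhs)
           (simp add: fun_eq_iff linear_scale[OF has_derivative_linear[OF F']] mult.commute)
      then have "(\<psi> has_real_derivative (F' e \<bullet> e)) (at ?r)"
        by (rule DERIV_cong_ev[THEN iffD1, rotated -1, OF _ refl _ refl])
           (use r e ee in \<open>auto simp: G_def eventually_nhds intro!: exI[of _ "{0<..}"]\<close>)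
      then show ?thesis by blast
    qed
    show ?thesis
      using fwd bwd by (metis add_diff_cancel_right' diff_add_cancel)
  qed
  finally show ?thesis .
qed

section \<open>Radial solutions and their flux\<close>

text \<open>
  The second-order radial equation \<open>- (r\<^bsup>n-1\<^esup> |u'|\<^bsup>p-2\<^esup> u')' = r\<^bsup>n-1\<^esup> h\<close> for a decreasing \<open>u\<close>, as a
  first-order system for \<open>u\<close> and its inward flux \<open>F = r\<^bsup>n-1\<^esup> |u'|\<^bsup>p-1\<^esup>\<close>. Positivity of \<open>F\<close> is part
  of the notion because the slope is recovered from it by a power.
\<close>

definition radial_flux ::
    "real \<Rightarrow> real \<Rightarrow> real \<Rightarrow> (real \<Rightarrow> real) \<Rightarrow> (real \<Rightarrow> real) \<Rightarrow> (real \<Rightarrow> real) \<Rightarrow> bool" where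
  "radial_flux n p \<rho> u F h \<longleftrightarrow>
     (\<forall>r. 0 < r \<and> r < \<rho> \<longrightarrow> F r > 0 \<and>
        (u has_real_derivative - ((F r * r powr (1 - n)) powr (1 / (p - 1)))) (at r) \<and>
        (F has_real_derivative r powr (n - 1) * h r) (at r))"

text \<open>
  Increments over \<open>[t, 2 t]\<close> have length proportional to their distance from the origin, so
  the mean value theorem turns them into \<open>r u'(r)\<close>. This is how continuity of \<open>u\<close> at the
  origin controls its slope.
\<close>

lemma dyadic_difference_tendsto_0:
  fixes u :: "real \<Rightarrow> real"
  assumes "(u \<longlongrightarrow> u0) (at_right 0)"
  shows "((\<lambda>t. u t - u (2 * t)) \<longlongrightarrow> 0) (at_right 0)"
proof -
  have "filterlim (\<lambda>t::real. 2 * t) (at_right 0) (at_right 0)"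
    unfolding filterlim_at
    by (auto intro!: tendsto_eq_intros simp: eventually_at_filter)
  from tendsto_diff[OF assms filterlim_compose[OF assms this]] show ?thesis by simp
qed

lemma dyadic_MVT:
  fixes u w :: "real \<Rightarrow> real"
  assumes "0 < t" "2 * t < \<rho>" and D: "\<And>r. 0 < r \<Longrightarrow> r < \<rho> \<Longrightarrow> (u has_real_derivative w r) (at r)"
  obtains \<xi> where "t < \<xi>" "\<xi> < 2 * t" "u (2 * t) - u t = t * w \<xi>"
proof -
  have "\<exists>\<xi>. t < \<xi> \<and> \<xi> < 2 * t \<and> u (2 * t) - u t = (2 * t - t) * w \<xi>"
    by (rule MVT2) (use assms in auto)
  then show ?thesis using that by auto
qed

text \<open>
  If the increasing function \<open>F\<close> were nonpositive somewhere, it would be below some \<open>- c < 0\<close> near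
  the origin. The relation \<open>(r u')\<^bsup>p-1\<^esup> = - F r\<^bsup>p-n\<^esup>\<close> with \<open>p < n\<close> then keeps \<open>r u'\<close> above a positive
  constant, and the dyadic increments of \<open>u\<close> could not tend to zero.
\<close>

lemma flux_positive:
  fixes u w F :: "real \<Rightarrow> real"
  assumes p: "1 < p" "p < n"
    and D: "\<And>r. 0 < r \<Longrightarrow> r < \<rho> \<Longrightarrow> (u has_real_derivative w r) (at r)"
    and F: "\<And>r. 0 < r \<Longrightarrow> r < \<rho> \<Longrightarrow> F r = - (r powr (n - 1) * (\<bar>w r\<bar> powr (p - 2) * w r))"
    and inc: "\<And>x y. 0 < x \<Longrightarrow> x < y \<Longrightarrow> y < \<rho> \<Longrightarrow> F x < F y"
    and u0: "(u \<longlongrightarrow> u0) (at_right 0)"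
    and r: "0 < r" "r < \<rho>"
  shows "F r > 0"
proof (rule ccontr)
  assume "\<not> F r > 0"
  define c where "c = - F (r / 2)"
  have c: "c > 0" using \<open>\<not> F r > 0\<close> inc[of "r/2" r] r by (simp add: c_def)
  \<comment> \<open>The lower bound for \<open>t w(t)\<close> on \<open>(0, r / 2)\<close> that comes from the bound \<open>c\<close> on the outward flux.\<close>
  define k where "k = (c * (r / 2) powr (p - n)) powr (1 / (p - 1))"
  have k: "k > 0" using c r by (simp add: k_def)
  have tw: "t * w t \<ge> k" if t: "0 < t" "t < r / 2" for t
  proof -
    have "- F t \<ge> c" using inc[of t "r/2"] t r by (simp add: c_def)
    then have Ft: "t powr (n - 1) * (\<bar>w t\<bar> powr (p - 2) * w t) \<ge> c"
      using F[of t] t r by simp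
    then have "t powr (n - 1) * (\<bar>w t\<bar> powr (p - 2) * w t) > 0" using c by linarith
    then have w: "w t > 0" by (auto simp: zero_less_mult_iff split: if_splits)
    have "(t * w t) powr (p - 1) = t powr (p - n) * (t powr (n - 1) * (\<bar>w t\<bar> powr (p - 2) * w t))"
    proof -
      have "t powr (p - n) * t powr (n - 1) = t powr (p - 1)"
        using t by (simp add: powr_add[symmetric])
      moreover have "w t powr (p - 2) * w t = w t powr (p - 1)"
        using w powr_add[of "w t" "p - 2" 1] by simp
      ultimately show ?thesis using t w by (simp add: powr_mult mult.assoc[symmetric])
    qed
    also have "\<dots> \<ge> (r / 2) powr (p - n) * c"
      using t p Ft c by (intro mult_mono powr_mono2') auto
    finally have "(c * (r / 2) powr (p - n)) powr (1 / (p - 1)) \<le> ((t * w t) powr (p - 1)) powr (1 / (p - 1))"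
      using c p by (intro powr_mono2) (auto simp: mult.commute)
    then show ?thesis using p t w by (simp add: k_def powr_powr)
  qed
  have "\<forall>\<^sub>F t in at_right 0. dist (u t - u (2 * t)) 0 < k / 2"
    using dyadic_difference_tendsto_0[OF u0] k by (intro tendstoD) auto
  moreover have "\<forall>\<^sub>F t in at_right 0. t < r / 4" "\<forall>\<^sub>F t in at_right 0. (t::real) > 0"
    using r by (auto simp: eventually_at_right_field intro!: exI[of _ "r/4"])
  ultimately have "\<forall>\<^sub>F t::real in at_right 0. False"
  proof eventually_elim
    case (elim t)
    obtain \<xi> where \<xi>: "t < \<xi>" "\<xi> < 2 * t" "u (2 * t) - u t = t * w \<xi>"
      using dyadic_MVT[of t \<rho> u w] elim D r by auto
    have "w \<xi> > 0" using tw[of \<xi>] \<xi> elim k zero_less_mult_pos[of \<xi> "w \<xi>"] by auto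
    then have "\<xi> * w \<xi> \<le> (2 * t) * w \<xi>" using \<xi> by (intro mult_right_mono) auto
    moreover have "\<bar>u t - u (2 * t)\<bar> = t * w \<xi>"
    proof -
      have "t * w \<xi> > 0" using elim \<open>w \<xi> > 0\<close> by simp
      then show ?thesis using \<xi>(3) by linarith
    qed
    moreover have "\<xi> * w \<xi> \<ge> k" using tw[of \<xi>] \<xi> elim by auto
    ultimately show False using elim(1) by (simp add: dist_real_def)
  qed
  then show False by simp
qed

text \<open>
  This is where regularity at the origin enters: it fixes the sign of the flux, and with it the
  sign of \<open>u'\<close>, so that the slope can be recovered from the flux by a power.
\<close>

lemma radial_flux_if_p_laplacian:
  fixes u h :: "real \<Rightarrow> real"
  assumes n: "n = real DIM('a::euclidean_space)" and p: "1 < p" "p < n"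
    and D: "\<And>r. 0 < r \<Longrightarrow> r < \<rho> \<Longrightarrow> (u has_real_derivative w r) (at r)"
    and lap: "\<And>x::'a. x \<noteq> 0 \<Longrightarrow> norm x < \<rho> \<Longrightarrow>
                has_p_laplacian p (\<lambda>y. u (norm y)) (- h (norm x)) x"
    and h: "\<And>r. 0 < r \<Longrightarrow> r < \<rho> \<Longrightarrow> h r > 0"
    and u0: "(u \<longlongrightarrow> u0) (at_right 0)"
  shows "\<exists>F. radial_flux n p \<rho> u F h"
proof -
  define \<psi> where "\<psi> = (\<lambda>r. \<bar>w r\<bar> powr (p - 2) * w r)"
  define F where "F = (\<lambda>r. - (r powr (n - 1) * \<psi> r))"
  have d\<psi>: "(\<psi> has_real_derivative (- h r - (n - 1) / r * \<psi> r)) (at r)"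
    if r: "0 < r" "r < \<rho>" for r
  proof -
    obtain e :: 'a where e: "e \<in> Basis" using nonempty_Basis by blast
    have x: "r *\<^sub>R e \<noteq> 0" "norm (r *\<^sub>R e) = r" "norm e = 1" using e r by auto
    have "\<forall>\<^sub>F r in nhds (norm (r *\<^sub>R e)). (u has_real_derivative w r) (at r)"
      unfolding x using D r eventually_nhds_in_open[of "{0<..<\<rho>}" r]
      by (auto elim: eventually_mono)
    from has_p_laplacian_radial_iff[OF x(1) this, of p "- h r"]
    show ?thesis using lap[OF x(1)] r by (simp add: x \<psi>_def n)
  qed
  have dF: "(F has_real_derivative r powr (n - 1) * h r) (at r)" if r: "0 < r" "r < \<rho>" for r
  proof -
    have e: "r powr (n - 1 - 1) = r powr (n - 1) / r"
      using r powr_diff[of r "n - 1" 1] by simp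
    have "(F has_real_derivative - (r powr (n - 1) * (- h r - (n - 1) / r * \<psi> r)
        + (n - 1) * r powr (n - 1 - 1) * \<psi> r)) (at r)"
      unfolding F_def
      by (rule DERIV_minus[OF DERIV_mult'[OF has_real_derivative_powr[OF r(1)] d\<psi>[OF r]]])
    then show ?thesis unfolding e by (simp add: algebra_simps)
  qed
  have inc: "F x < F y" if "0 < x" "x < y" "y < \<rho>" for x y
  proof (rule DERIV_pos_imp_increasing[OF that(2)])
    fix z assume "x \<le> z" "z \<le> y"
    then have z: "0 < z" "z < \<rho>" using that by auto
    show "\<exists>d. (F has_real_derivative d) (at z) \<and> d > 0"
      using dF[OF z] h[OF z] z by (intro exI[of _ "z powr (n - 1) * h z"]) simp
  qed
  have Fpos: "F r > 0" if "0 < r" "r < \<rho>" for r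
    by (rule flux_positive[OF p D _ inc u0 that]) (auto simp: F_def \<psi>_def)
  have weq: "w r = - ((F r * r powr (1 - n)) powr (1 / (p - 1)))" if r: "0 < r" "r < \<rho>" for r
  proof -
    have "r powr (n - 1) * (\<bar>w r\<bar> powr (p - 2) * w r) < 0"
      using Fpos[OF r] by (simp add: F_def \<psi>_def)
    then have w: "w r < 0" by (auto simp: mult_less_0_iff)
    have "F r * r powr (1 - n) = (- w r) powr (p - 2) * (- w r) powr 1"
      using r w by (simp add: F_def \<psi>_def powr_diff)
    also have "\<dots> = (- w r) powr (p - 1)"
      unfolding powr_add[symmetric] by simp
    finally show ?thesis using w p by (simp add: powr_powr)
  qed
  then show ?thesis
    unfolding radial_flux_def
  proof (intro exI[of _ F] allI impI conjI; elim conjE)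
    fix r assume r: "0 < r" "r < \<rho>"
    show "(u has_real_derivative - ((F r * r powr (1 - n)) powr (1 / (p - 1)))) (at r)"
      using D[OF r] unfolding weq[OF r] .
  qed (use dF Fpos in auto)
qed

text \<open>
  The quantity \<open>F r\<^bsup>1-n\<^esup> = |u'|\<^bsup>p-1\<^esup>\<close> is the flux per unit of area. Its equation is the radial
  p-Laplace equation written for a single function of \<open>r\<close>.
\<close>

lemma radial_flux_density_deriv:
  assumes flux: "radial_flux n p \<rho> u F h" and r: "0 < r" "r < \<rho>"
  shows "((\<lambda>r. F r * r powr (1 - n)) has_real_derivative
           h r - (n - 1) / r * (F r * r powr (1 - n))) (at r)"
proof -
  have dF: "(F has_real_derivative r powr (n - 1) * h r) (at r)"
    using flux r by (auto simp: radial_flux_def)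
  have e: "r powr (1 - n - 1) = r powr (1 - n) / r" "r powr (n - 1) * r powr (1 - n) = 1"
    using r powr_diff[of r "1 - n" 1] by (simp_all add: powr_add[symmetric])
  have "((\<lambda>r. F r * r powr (1 - n)) has_real_derivative
      F r * ((1 - n) * r powr (1 - n - 1)) + r powr (n - 1) * h r * r powr (1 - n)) (at r)"
    by (rule DERIV_mult'[OF dF has_real_derivative_powr[OF r(1)]])
  moreover have "r powr (n - 1) * h r * r powr (1 - n) = h r"
    using e(2) by (simp add: mult.commute mult.left_commute)
  moreover have "F r * ((1 - n) * (r powr (1 - n) / r)) + h r
      = h r - (n - 1) / r * (F r * r powr (1 - n))"
    using r by (simp add: field_simps)
  ultimately show ?thesis
    unfolding e(1) by (simp only:)
qed

lemma radial_flux_slope_deriv: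
  assumes flux: "radial_flux n p \<rho> u F h" and r: "0 < r" "r < \<rho>"
  shows "((\<lambda>r. (F r * r powr (1 - n)) powr \<alpha>) has_real_derivative
           (F r * r powr (1 - n)) powr \<alpha> * \<alpha> * (r powr (n - 1) * h r / F r - (n - 1) / r)) (at r)"
proof -
  have F: "F r > 0" using flux r by (auto simp: radial_flux_def)
  let ?X = "F r * r powr (1 - n)" and ?k = "r powr (n - 1) * h r / F r - (n - 1) / r"
  have X: "?X > 0" using F r by simp
  have "r powr (n - 1) * r powr (1 - n) = 1"
    using r by (simp add: powr_add[symmetric])
  then have "(r powr (n - 1) * h r / F r) * ?X = h r"
    using F by (simp add: mult.commute mult.left_commute)
  then have "h r - (n - 1) / r * ?X = ?k * ?X"
    by (simp add: left_diff_distrib)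
  then have "((\<lambda>r. F r * r powr (1 - n)) has_real_derivative ?k * ?X) (at r)"
    using radial_flux_density_deriv[OF flux r] by (simp only:)
  from DERIV_powr[OF this X DERIV_const[of \<alpha>]] show ?thesis
    using F r by (simp add: mult_ac)
qed

lemma p_laplacian_if_radial_flux:
  fixes x :: "'a::euclidean_space"
  assumes n: "n = real DIM('a)" and p: "1 < p"
    and flux: "radial_flux n p \<rho> u F h" and x: "x \<noteq> 0" "norm x < \<rho>"
  shows "has_p_laplacian p (\<lambda>y. u (norm y)) (- h (norm x)) x"
proof -
  let ?r = "norm x"
  define X where "X = (\<lambda>r. F r * r powr (1 - n))"
  define w where "w = (\<lambda>r. - (X r powr (1 / (p - 1))))"
  have r: "0 < ?r" "?r < \<rho>" using x by auto
  have Xpos: "X r > 0" if "0 < r" "r < \<rho>" for r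
    using flux that by (simp add: radial_flux_def X_def)
  have ev: "\<forall>\<^sub>F r in nhds ?r. 0 < r \<and> r < \<rho>"
    using r eventually_nhds_in_open[of "{0<..<\<rho>}" ?r] by simp
  then have D: "\<forall>\<^sub>F r in nhds ?r. (u has_real_derivative w r) (at r)"
    by eventually_elim (use flux in \<open>auto simp: radial_flux_def w_def X_def\<close>)
  have wX: "\<bar>w r\<bar> powr (p - 2) * w r = - X r" if "0 < r" "r < \<rho>" for r
  proof -
    have "1 / (p - 1) * (p - 2) + 1 / (p - 1) = 1" using p by (simp add: field_simps)
    then show ?thesis
      using Xpos[OF that] p by (simp add: w_def powr_powr powr_add[symmetric])
  qed
  have dX: "(X has_real_derivative h ?r - (n - 1) / ?r * X ?r) (at ?r)"
    unfolding X_def by (rule radial_flux_density_deriv[OF flux r])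
  have "\<forall>\<^sub>F r in nhds ?r. \<bar>w r\<bar> powr (p - 2) * w r = - X r"
    using ev by eventually_elim (use wX in auto)
  then have "((\<lambda>r. \<bar>w r\<bar> powr (p - 2) * w r) has_real_derivative
      - (h ?r - (n - 1) / ?r * X ?r)) (at ?r)"
    using DERIV_minus[OF dX] by (subst DERIV_cong_ev[OF refl _ refl])
  then show ?thesis
    using has_p_laplacian_radial_iff[OF x(1) D, of p "- h ?r"] wX[OF r] by (simp add: n)
qed

text \<open>
  Since the flux never vanishes, the power \<open>1 / (p - 1)\<close> is applied away from its singularity at 0,
  and \<open>u'\<close> inherits the regularity of the flux for every \<open>p\<close>.
\<close>

lemma C2_if_radial_flux:
  assumes flux: "radial_flux n p \<rho> u F h" and h: "continuous_on {0<..<\<rho>} h"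
  shows "C2_on {r. 0 < r \<and> ereal r < ereal \<rho>} u"
proof -
  let ?\<alpha> = "1 / (p - 1)"
  have S: "{r. 0 < r \<and> ereal r < ereal \<rho>} = {0<..<\<rho>}" by auto
  have F: "continuous_on {0<..<\<rho>} F"
    by (rule DERIV_continuous_on[OF has_field_derivative_at_within])
       (use flux in \<open>auto simp: radial_flux_def\<close>)
  have nz: "F r \<noteq> 0" if "r \<in> {0<..<\<rho>}" for r using flux that by (force simp: radial_flux_def)
  have "continuous_on {0<..<\<rho>} (\<lambda>r. - ((F r * r powr (1 - n)) powr ?\<alpha> * ?\<alpha> *
      (r powr (n - 1) * h r / F r - (n - 1) / r)))"
    by (intro continuous_intros F h) (auto simp: nz)
  moreover have "((\<lambda>r. - ((F r * r powr (1 - n)) powr ?\<alpha>)) has_real_derivative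
      - ((F r * r powr (1 - n)) powr ?\<alpha> * ?\<alpha> * (r powr (n - 1) * h r / F r - (n - 1) / r))) (at r)"
    if "0 < r" "r < \<rho>" for r
    by (rule DERIV_minus[OF radial_flux_slope_deriv[OF flux that]])
  moreover have "(u has_real_derivative - ((F r * r powr (1 - n)) powr ?\<alpha>)) (at r)"
    if "0 < r" "r < \<rho>" for r
    using flux that by (simp add: radial_flux_def)
  ultimately show ?thesis
    unfolding C2_on_def S
    by (intro exI[of _ "\<lambda>r. - ((F r * r powr (1 - n)) powr ?\<alpha>)"] exI conjI) auto
qed

section \<open>The Pohozaev inequality\<close>

lemma radial_flux_strictly_decreasing:
  assumes flux: "radial_flux n p \<rho> u F h" and xy: "0 < x" "x < y" "y < \<rho>"
  shows "u y < u x"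
proof (rule DERIV_neg_imp_decreasing[OF xy(2)])
  fix z assume "x \<le> z" "z \<le> y"
  then have z: "0 < z" "z < \<rho>" using xy by auto
  then have "F z > 0" using flux by (simp add: radial_flux_def)
  then show "\<exists>d. (u has_real_derivative d) (at z) \<and> d < 0"
    using flux z
    by (intro exI[of _ "- ((F z * z powr (1 - n)) powr (1 / (p - 1)))"])
       (auto simp: radial_flux_def)
qed

lemma radial_flux_strictly_increasing:
  assumes flux: "radial_flux n p \<rho> u F h" and h: "\<And>r. 0 < r \<Longrightarrow> r < \<rho> \<Longrightarrow> h r > 0"
    and xy: "0 < x" "x < y" "y < \<rho>"
  shows "F x < F y"
proof (rule DERIV_pos_imp_increasing[OF xy(2)])
  fix z assume "x \<le> z" "z \<le> y"
  then have z: "0 < z" "z < \<rho>" using xy by auto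
  show "\<exists>d. (F has_real_derivative d) (at z) \<and> d > 0"
    using flux z h[OF z] by (intro exI[of _ "z powr (n - 1) * h z"]) (simp add: radial_flux_def)
qed

text \<open>
  All factors of \<open>F'\<close> are bounded near a finite endpoint because \<open>u\<close> and \<open>V\<close> decrease.
  Towards the origin \<open>F\<close> stays below its value at \<open>\<rho> / 2\<close> because it increases.
\<close>

lemma radial_flux_bounded:
  assumes flux: "radial_flux n p \<rho> u F (\<lambda>r. r powr a * u r powr s * V r)"
    and s: "s \<ge> 0" and \<rho>: "\<rho> > 0"
    and u: "\<And>r. 0 < r \<Longrightarrow> r < \<rho> \<Longrightarrow> u r > 0"
    and V: "\<And>r. 0 < r \<Longrightarrow> r < \<rho> \<Longrightarrow> V r > 0"
    and Vdec: "\<And>x y. 0 < x \<Longrightarrow> x < y \<Longrightarrow> y < \<rho> \<Longrightarrow> V y \<le> V x"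
  shows "\<exists>M>0. \<forall>r. 0 < r \<and> r < \<rho> \<longrightarrow> F r \<le> M"
proof -
  define r0 where "r0 = \<rho> / 2"
  have r0: "0 < r0" "r0 < \<rho>" using \<rho> by (auto simp: r0_def)
  have "continuous_on {r0..\<rho>} (\<lambda>r. r powr (n - 1 + a))"
    using r0 by (intro continuous_intros) auto
  then have "bounded ((\<lambda>r. r powr (n - 1 + a)) ` {r0..\<rho>})"
    by (intro compact_imp_bounded compact_continuous_image) auto
  then obtain B where "\<forall>r\<in>{r0..\<rho>}. r powr (n - 1 + a) \<le> B"
    by (auto simp: bounded_iff)
  then have B: "r0 \<le> r \<Longrightarrow> r \<le> \<rho> \<Longrightarrow> r powr (n - 1 + a) \<le> B" for r by simp
  define K where "K = B * (u r0 powr s * V r0)"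
  have B0: "B \<ge> 0" using B[of r0] r0 by (meson order_trans powr_ge_zero less_imp_le order_refl)
  have K: "K \<ge> 0" unfolding K_def using B0 V[OF r0] by simp
  have inc: "F x < F y" if "0 < x" "x < y" "y < \<rho>" for x y
  proof (rule radial_flux_strictly_increasing[OF flux _ that])
    fix r assume r: "0 < r" "r < \<rho>"
    show "r powr a * u r powr s * V r > 0" using u[OF r] V[OF r] r by simp
  qed
  have upper: "F r \<le> F r0 + K * \<rho>" if r: "r0 < r" "r < \<rho>" for r
  proof -
    have "\<exists>z. r0 < z \<and> z < r \<and>
        F r - F r0 = (r - r0) * (z powr (n - 1) * (z powr a * u z powr s * V z))"
      by (rule MVT2) (use r r0 flux in \<open>auto simp: radial_flux_def\<close>)
    then obtain z where z: "r0 < z" "z < r"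
      and eq: "F r - F r0 = (r - r0) * (z powr (n - 1) * (z powr a * u z powr s * V z))"
      by blast
    have zp: "0 < z" "z < \<rho>" using z r r0 by auto
    have "z powr (n - 1) * (z powr a * u z powr s * V z) = z powr (n - 1 + a) * (u z powr s * V z)"
      by (simp add: powr_add)
    also have "\<dots> \<le> K"
      unfolding K_def
    proof (intro mult_mono powr_mono2)
      show "z powr (n - 1 + a) \<le> B" using B[of z] z r by auto
      show "u z \<le> u r0" using radial_flux_strictly_decreasing[OF flux r0(1) z(1) zp(2)] by simp
      show "V z \<le> V r0" using Vdec[OF r0(1) z(1) zp(2)] .
    qed (use s u[OF zp] V[OF zp] B0 in auto)
    finally have "F r - F r0 \<le> (r - r0) * K"
      unfolding eq using r by (intro mult_left_mono) auto
    also have "\<dots> \<le> \<rho> * K" using r r0 K by (intro mult_right_mono) auto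
    finally show ?thesis by (simp add: mult.commute)
  qed
  have F0: "F r0 > 0" using flux r0 by (simp add: radial_flux_def)
  show ?thesis
  proof (intro exI[of _ "F r0 + K * \<rho>"] conjI allI impI)
    show "F r0 + K * \<rho> > 0" using F0 K \<rho> by (simp add: add_pos_nonneg)
    fix r assume r: "0 < r \<and> r < \<rho>"
    have "K * \<rho> \<ge> 0" using K \<rho> by simp
    then show "F r \<le> F r0 + K * \<rho>"
      using upper[of r] inc[of r r0] r r0 by (cases r r0 rule: linorder_cases) auto
  qed
qed

text \<open>
  The scale-invariant form of the slope: comparing its values at two points only requires
  comparing the fluxes and the radii.
\<close>

lemma radius_times_slope:
  fixes n p t F :: real
  assumes "1 < p" "t > 0" "F > 0"
  shows "t * (F * t powr (1 - n)) powr (1 / (p - 1)) = (F * t powr (p - n)) powr (1 / (p - 1))"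
proof -
  have "t = (t powr (p - 1)) powr (1 / (p - 1))"
    using assms by (simp add: powr_powr)
  then have "t * (F * t powr (1 - n)) powr (1 / (p - 1))
      = (t powr (p - 1) * (F * t powr (1 - n))) powr (1 / (p - 1))"
    using assms by (simp add: powr_mult)
  also have "t powr (p - 1) * (F * t powr (1 - n)) = F * t powr (p - n)"
    by (simp add: powr_add[symmetric] mult.left_commute)
  finally show ?thesis .
qed

text \<open>
  As \<open>F\<close> increases, \<open>t W(t)\<close> is at most a constant times \<open>\<xi> W(\<xi>)\<close> for every \<open>\<xi>\<close> between \<open>t\<close> and
  \<open>2 t\<close>. The mean value theorem supplies a \<open>\<xi>\<close> at which the latter is at most twice the increment
  of \<open>u\<close>. The flux follows from \<open>F = r\<^bsup>n-p\<^esup> (r W)\<^bsup>p-1\<^esup>\<close>.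
\<close>

lemma radius_times_slope_tendsto_0:
  assumes p: "1 < p" "p < n" and \<rho>: "\<rho> > 0"
    and flux: "radial_flux n p \<rho> u F h" and h: "\<And>r. 0 < r \<Longrightarrow> r < \<rho> \<Longrightarrow> h r > 0"
    and u0: "(u \<longlongrightarrow> u0) (at_right 0)"
  shows "((\<lambda>r. r * (F r * r powr (1 - n)) powr (1 / (p - 1))) \<longlongrightarrow> 0) (at_right 0)"
    and "(F \<longlongrightarrow> 0) (at_right 0)"
proof -
  define Z where "Z = (\<lambda>r. r * (F r * r powr (1 - n)) powr (1 / (p - 1)))"
  have Fpos: "F r > 0" if "0 < r" "r < \<rho>" for r using flux that by (simp add: radial_flux_def)
  define k where "k = 2 powr ((p - n) / (p - 1))"
  have k: "k > 0" by (simp add: k_def)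
  have small: "\<forall>\<^sub>F t in at_right 0. 0 < t \<and> 2 * t < \<rho>"
    using \<rho> by (auto simp: eventually_at_right_field intro!: exI[of _ "\<rho>/2"])
  have bound: "Z t \<le> 2 / k * (u t - u (2 * t)) \<and> 0 \<le> Z t" if t: "0 < t" "2 * t < \<rho>" for t
  proof -
    obtain \<xi> where \<xi>: "t < \<xi>" "\<xi> < 2 * t"
      "u (2 * t) - u t = t * - ((F \<xi> * \<xi> powr (1 - n)) powr (1 / (p - 1)))"
      using dyadic_MVT[of t \<rho> u "\<lambda>r. - ((F r * r powr (1 - n)) powr (1 / (p - 1)))"] t flux
      by (auto simp: radial_flux_def)
    have "k * Z t = (2 powr (p - n)) powr (1 / (p - 1)) * (F t * t powr (p - n)) powr (1 / (p - 1))"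
      unfolding Z_def k_def using t Fpos[of t] p by (simp add: radius_times_slope powr_powr)
    also have "\<dots> = (F t * (2 * t) powr (p - n)) powr (1 / (p - 1))"
      using t Fpos[of t] by (simp add: powr_mult[symmetric] mult.left_commute)
    also have "\<dots> \<le> (F \<xi> * \<xi> powr (p - n)) powr (1 / (p - 1))"
    proof (rule powr_mono2)
      show "F t * (2 * t) powr (p - n) \<le> F \<xi> * \<xi> powr (p - n)"
      proof (rule mult_mono)
        show "F t \<le> F \<xi>"
          using radial_flux_strictly_increasing[OF flux h, of t \<xi>] t \<xi> by auto
        show "(2 * t) powr (p - n) \<le> \<xi> powr (p - n)"
          using t \<xi> p by (intro powr_mono2') auto
      qed (use t \<xi> Fpos[of t] Fpos[of \<xi>] in auto)
    qed (use t p Fpos[of t] in auto)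
    also have "\<dots> = Z \<xi>" unfolding Z_def using t \<xi> Fpos[of \<xi>] p by (simp add: radius_times_slope)
    also have "\<dots> \<le> 2 * t * (F \<xi> * \<xi> powr (1 - n)) powr (1 / (p - 1))"
      unfolding Z_def using \<xi> by (intro mult_right_mono) auto
    also have "\<dots> = 2 * (u t - u (2 * t))" using \<xi>(3) by simp
    finally show ?thesis using k t by (simp add: field_simps Z_def)
  qed
  have Z0: "(Z \<longlongrightarrow> 0) (at_right 0)"
  proof (rule tendsto_sandwich[OF _ _ tendsto_const])
    show "((\<lambda>t. 2 / k * (u t - u (2 * t))) \<longlongrightarrow> 0) (at_right 0)"
      using tendsto_mult[OF tendsto_const[of "2 / k"] dyadic_difference_tendsto_0[OF u0]] by simp
    show "\<forall>\<^sub>F t in at_right 0. 0 \<le> Z t"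
      using small by eventually_elim (use bound in blast)
    show "\<forall>\<^sub>F t in at_right 0. Z t \<le> 2 / k * (u t - u (2 * t))"
      using small by eventually_elim (use bound in blast)
  qed
  then show "((\<lambda>r. r * (F r * r powr (1 - n)) powr (1 / (p - 1))) \<longlongrightarrow> 0) (at_right 0)"
    by (simp add: Z_def)
  have "((\<lambda>r. r powr (n - p) * Z r powr (p - 1)) \<longlongrightarrow> 0 powr (n - p) * 0 powr (p - 1)) (at_right 0)"
    using p small bound
    by (intro tendsto_mult tendsto_powr' Z0 tendsto_ident_at tendsto_const disjI2 conjI)
       (auto elim!: eventually_mono)
  moreover have "\<forall>\<^sub>F r in at_right 0. r powr (n - p) * Z r powr (p - 1) = F r"
    using small
  proof eventually_elim
    case (elim r)
    have "r powr (n - p) * r powr (p - n) = 1" using elim by (simp add: powr_add[symmetric])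
    then show ?case
      using elim Fpos[of r] p
      by (simp add: Z_def radius_times_slope powr_powr mult.left_commute)
  qed
  ultimately show "(F \<longlongrightarrow> 0) (at_right 0)"
    using tendsto_cong by force
qed

text \<open>
  The energy \<open>E\<close> starts from 0 at the origin and strictly decreases, so it is below a negative
  constant from \<open>\<rho> / 2\<close> on. Its only negative term is \<open>- (n - p) / p F u\<close>, and a bounded
  flux then prevents \<open>u\<close> from approaching zero.
\<close>

lemma pohozaev_lower_bound:
  assumes p: "1 < p" "p < n" and \<rho>: "\<rho> > 0" and na: "n + a > 0" and s: "s \<ge> 0"
    and crit: "s + 1 \<ge> p * (n + a) / (n - p)"
    and flux: "radial_flux n p \<rho> u F (\<lambda>r. r powr a * u r powr s * V r)"
    and u: "\<And>r. 0 < r \<Longrightarrow> r < \<rho> \<Longrightarrow> u r > 0"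
    and V: "\<And>r. 0 < r \<Longrightarrow> r < \<rho> \<Longrightarrow> V r > 0"
    and dV: "\<And>r. 0 < r \<Longrightarrow> r < \<rho> \<Longrightarrow> (V has_real_derivative V' r) (at r) \<and> V' r < 0"
    and u0: "(u \<longlongrightarrow> u0) (at_right 0)" and V0: "(V \<longlongrightarrow> V0) (at_right 0)"
  shows "\<exists>c>0. \<forall>r. 0 < r \<and> r < \<rho> \<longrightarrow> c \<le> u r"
proof -
  define W where "W = (\<lambda>r. (F r * r powr (1 - n)) powr (1 / (p - 1)))"
  define E where "E = (\<lambda>r. (p - 1) / p * (F r * (r * W r))
      + r powr (n + a) * (u r powr (s + 1) * V r) / (s + 1) - (n - p) / p * (F r * u r))"
  have h: "r powr a * u r powr s * V r > 0" if "0 < r" "r < \<rho>" for r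
    using u[OF that] V[OF that] that by simp
  have Fpos: "F r > 0" if "0 < r" "r < \<rho>" for r using flux that by (simp add: radial_flux_def)
  have small: "\<forall>\<^sub>F t in at_right 0. 0 < t \<and> t < \<rho>"
    using \<rho> by (auto simp: eventually_at_right_field intro!: exI[of _ "\<rho>"])
  have E0: "(E \<longlongrightarrow> 0) (at_right 0)"
  proof -
    have "((\<lambda>r. r powr (n + a)) \<longlongrightarrow> 0 powr (n + a)) (at_right 0)"
      using na small by (intro tendsto_powr' tendsto_ident_at tendsto_const)
        (auto elim!: eventually_mono)
    moreover have "((\<lambda>r. u r powr (s + 1)) \<longlongrightarrow> u0 powr (s + 1)) (at_right 0)"
      using s small u by (intro tendsto_powr' u0 tendsto_const disjI2)
        (auto elim!: eventually_mono intro: less_imp_le)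
    ultimately have R: "((\<lambda>r. r powr (n + a) * (u r powr (s + 1) * V r) / (s + 1)) \<longlongrightarrow>
        0 powr (n + a) * (u0 powr (s + 1) * V0) / (s + 1)) (at_right 0)"
      using s by (intro tendsto_divide tendsto_mult[OF _ tendsto_mult[OF _ V0]] tendsto_const) auto
    note Z = radius_times_slope_tendsto_0[OF p \<rho> flux h u0]
    have "(E \<longlongrightarrow> (p - 1) / p * (0 * 0) + 0 powr (n + a) * (u0 powr (s + 1) * V0) / (s + 1)
        - (n - p) / p * (0 * u0)) (at_right 0)"
      unfolding E_def W_def
      by (intro tendsto_diff tendsto_add tendsto_mult[OF tendsto_const] tendsto_mult[OF Z(2)]
            Z(1) u0 R)
    then show ?thesis by simp
  qed
  have dE: "\<exists>d. (E has_real_derivative d) (at r) \<and> d < 0" if r: "0 < r" "r < \<rho>" for r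
  proof -
    define H where "H = r powr (n - 1) * (r powr a * u r powr s * V r)"
    have Hpos: "H > 0" using h[OF r] r by (simp add: H_def)
    have dF: "(F has_real_derivative H) (at r)" and du: "(u has_real_derivative - W r) (at r)"
      using flux r by (simp_all add: radial_flux_def H_def W_def)
    define D where "D = W r * (1 / (p - 1)) * (H / F r - (n - 1) / r)"
    have dW: "(W has_real_derivative D) (at r)"
      unfolding W_def D_def H_def by (rule radial_flux_slope_deriv[OF flux r])
    have dup: "((\<lambda>r. u r powr (s + 1)) has_real_derivative (s + 1) * u r powr s * - W r) (at r)"
      using DERIV_fun_powr[OF du u[OF r], of "s + 1"] by simp
    have drp: "((\<lambda>r. r powr (n + a)) has_real_derivative (n + a) * r powr (n + a - 1)) (at r)"
      by (rule has_real_derivative_powr[OF r(1)])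
    define d where "d = (p - 1) / p * (F r * (r * D + 1 * W r) + H * (r * W r))
      + (r powr (n + a) * (u r powr (s + 1) * V' r + (s + 1) * u r powr s * - W r * V r)
         + (n + a) * r powr (n + a - 1) * (u r powr (s + 1) * V r)) / (s + 1)
      - (n - p) / p * (F r * - W r + H * u r)"
    have "(E has_real_derivative d) (at r)"
      unfolding E_def d_def
      by (rule DERIV_diff[OF DERIV_add[OF
            DERIV_cmult[OF DERIV_mult'[OF dF DERIV_mult'[OF DERIV_ident dW]]]
            DERIV_cdivide[OF DERIV_mult'[OF drp DERIV_mult'[OF dup conjunct1[OF dV[OF r]]]]]]
            DERIV_cmult[OF DERIV_mult'[OF dF du]]])
    moreover have "d < 0"
    proof -
      have rH: "r powr (n + a) * (u r powr s * V r) = r * H"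
      proof -
        have "r powr (n + a) = r powr (1 + (n - 1) + a)" by simp
        also have "\<dots> = r * r powr (n - 1) * r powr a" using r by (simp only: powr_add) simp
        finally show ?thesis by (simp add: H_def)
      qed
      have Hu: "r powr (n + a - 1) * (u r powr (s + 1) * V r) = H * u r"
      proof -
        have "r powr (n + a - 1) = r powr ((n - 1) + a)" by (simp add: algebra_simps)
        also have "\<dots> = r powr (n - 1) * r powr a" by (simp only: powr_add)
        finally show ?thesis using u[OF r] by (simp add: H_def powr_add)
      qed
      have rD: "F r * (r * D) = W r / (p - 1) * (r * H - (n - 1) * F r)"
        unfolding D_def using Fpos[OF r] r p by (simp add: field_simps)
      have "d = (p - 1) / p * (W r / (p - 1) * (r * H - (n - 1) * F r) + F r * W r + H * (r * W r))
        + (r powr (n + a) * (u r powr (s + 1) * V' r)) / (s + 1)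
        + (- (s + 1) * W r * (r powr (n + a) * (u r powr s * V r))
        + (n + a) * (r powr (n + a - 1) * (u r powr (s + 1) * V r))) / (s + 1)
        - (n - p) / p * (F r * - W r + H * u r)"
        unfolding d_def rD[symmetric] by (simp add: algebra_simps add_divide_distrib diff_divide_distrib)
      also have "\<dots> = (p - 1) / p * (W r / (p - 1) * (r * H - (n - 1) * F r) + F r * W r + H * (r * W r))
        + (r powr (n + a) * (u r powr (s + 1) * V' r)) / (s + 1)
        + (- (s + 1) * W r * (r * H) + (n + a) * (H * u r)) / (s + 1)
        - (n - p) / p * (F r * - W r + H * u r)"
        unfolding rH Hu ..
      \<comment> \<open>The choice of the coefficients in \<open>E\<close> makes all terms with \<open>W\<close> cancel.\<close>
      also have "\<dots> = (r powr (n + a) * (u r powr (s + 1) * V' r)) / (s + 1)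
        + ((n + a) / (s + 1) - (n - p) / p) * (H * u r)"
      proof -
        have "(p - 1) / p * (W r / (p - 1) * (r * H - (n - 1) * F r) + F r * W r + H * (r * W r))
          = W r * r * H - (n - p) / p * (F r * W r)"
          using p by (simp add: field_simps)
        moreover have "(- (s + 1) * W r * (r * H) + (n + a) * (H * u r)) / (s + 1)
          = - (W r * r * H) + (n + a) / (s + 1) * (H * u r)"
          using s by (simp add: field_simps)
        ultimately show ?thesis by (simp add: algebra_simps)
      qed
      also have "\<dots> < 0"
      proof (rule add_neg_nonpos)
        have "r powr (n + a) * (u r powr (s + 1) * V' r) < 0"
          using r u[OF r] dV[OF r] by (simp add: mult_less_0_iff)
        then show "(r powr (n + a) * (u r powr (s + 1) * V' r)) / (s + 1) < 0"
          using s by (simp add: divide_neg_pos)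
        have "(n + a) / (s + 1) \<le> (n - p) / p"
          using crit p s by (simp add: field_simps)
        then show "((n + a) / (s + 1) - (n - p) / p) * (H * u r) \<le> 0"
          using Hpos u[OF r] by (intro mult_nonpos_nonneg) auto
      qed
      finally show ?thesis .
    qed
    ultimately show ?thesis by blast
  qed
  have Edec: "E y < E x" if "0 < x" "x < y" "y < \<rho>" for x y
    by (rule DERIV_neg_imp_decreasing[OF that(2)]) (use that dE in auto)
  define r0 where "r0 = \<rho> / 2"
  have r0: "0 < r0" "r0 < \<rho>" using \<rho> by (auto simp: r0_def)
  have "E (r0 / 2) \<le> 0"
  proof (rule tendsto_lowerbound[OF E0])
    have "\<forall>\<^sub>F t in at_right 0. 0 < t \<and> t < r0 / 2"
      using r0 by (auto simp: eventually_at_right_field intro!: exI[of _ "r0 / 2"])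
    then show "\<forall>\<^sub>F t in at_right 0. E (r0 / 2) \<le> E t"
      using r0 by (auto elim!: eventually_mono intro!: less_imp_le[OF Edec])
  qed simp
  then have Er0: "E r0 < 0" using Edec[of "r0/2" r0] r0 by simp
  obtain M where M: "M > 0" "\<And>r. 0 < r \<Longrightarrow> r < \<rho> \<Longrightarrow> F r \<le> M"
  proof -
    have "V y \<le> V x" if "0 < x" "x < y" "y < \<rho>" for x y
    proof (rule less_imp_le, rule DERIV_neg_imp_decreasing[OF that(2)])
      fix z assume "x \<le> z" "z \<le> y"
      then show "\<exists>d. (V has_real_derivative d) (at z) \<and> d < 0"
        using dV[of z] that by auto
    qed
    from radial_flux_bounded[OF flux s \<rho> u V this] show ?thesis using that by blast
  qed
  \<comment> \<open>From \<open>- E(r0) \<le> (n - p) / p F u \<le> (n - p) / p M u\<close> on \<open>[r0, \<rho>)\<close>.\<close>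
  define c where "c = - E r0 * p / ((n - p) * M)"
  have c: "c > 0" unfolding c_def using Er0 p M by (intro divide_pos_pos mult_pos_pos) auto
  have lower: "c \<le> u r" if r: "r0 \<le> r" "r < \<rho>" for r
  proof -
    have rp: "0 < r" using r r0 by auto
    have "E r \<le> E r0" using Edec[of r0 r] r r0 by (cases "r = r0") auto
    moreover have "E r \<ge> - ((n - p) / p * (F r * u r))"
      unfolding E_def using p s rp Fpos[OF rp r(2)] V[OF rp r(2)] by (simp add: W_def)
    ultimately have "- E r0 \<le> (n - p) / p * (F r * u r)" by linarith
    also have "\<dots> \<le> (n - p) / p * (M * u r)"
      using p M(2)[OF rp r(2)] u[OF rp r(2)] by (intro mult_left_mono mult_right_mono) auto
    finally show ?thesis unfolding c_def using p M(1) by (simp add: field_simps)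
  qed
  have "c \<le> u r" if r: "0 < r" "r < \<rho>" for r
  proof (cases "r0 \<le> r")
    case False
    then have "u r0 < u r" using radial_flux_strictly_decreasing[OF flux r(1) _ r0(2)] by simp
    then show ?thesis using lower[of r0] r0 by simp
  qed (use lower r in auto)
  then show ?thesis using c by blast
qed

section \<open>Local existence for Lipschitz vector fields\<close>

lemma lipschitz_mult_compact:
  fixes f g :: "'a::metric_space \<Rightarrow> real"
  assumes X: "compact X" and f: "\<exists>L. L-lipschitz_on X f" and g: "\<exists>L. L-lipschitz_on X g"
  shows "\<exists>L. L-lipschitz_on X (\<lambda>x. f x * g x)"
proof -
  obtain L M where L: "L-lipschitz_on X f" and M: "M-lipschitz_on X g"
    using f g by blast
  have "bounded (f ` X)" "bounded (g ` X)"
    using X L M by (auto intro!: compact_imp_bounded compact_continuous_image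
        lipschitz_on_continuous_on)
  then obtain A B where A: "\<And>x. x \<in> X \<Longrightarrow> \<bar>f x\<bar> \<le> A" and B: "\<And>x. x \<in> X \<Longrightarrow> \<bar>g x\<bar> \<le> B"
    by (auto simp: bounded_iff)
  have "(\<bar>A\<bar> * M + \<bar>B\<bar> * L)-lipschitz_on X (\<lambda>x. f x * g x)"
  proof (rule lipschitz_onI)
    show "0 \<le> \<bar>A\<bar> * M + \<bar>B\<bar> * L"
      using lipschitz_on_nonneg[OF L] lipschitz_on_nonneg[OF M] by simp
    fix x y assume xy: "x \<in> X" "y \<in> X"
    have "\<bar>f x * g x - f y * g y\<bar> = \<bar>f x * (g x - g y) + g y * (f x - f y)\<bar>"
      by (simp add: algebra_simps)
    also have "\<dots> \<le> \<bar>f x\<bar> * \<bar>g x - g y\<bar> + \<bar>g y\<bar> * \<bar>f x - f y\<bar>"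
      using abs_triangle_ineq[of "f x * (g x - g y)" "g y * (f x - f y)"] by (simp add: abs_mult)
    also have "\<dots> \<le> \<bar>A\<bar> * (M * dist x y) + \<bar>B\<bar> * (L * dist x y)"
      using lipschitz_onD[OF L xy] lipschitz_onD[OF M xy] A[OF xy(1)] B[OF xy(2)]
      by (intro add_mono mult_mono) (auto simp: dist_real_def)
    finally show "dist (f x * g x) (f y * g y) \<le> (\<bar>A\<bar> * M + \<bar>B\<bar> * L) * dist x y"
      by (simp add: dist_real_def algebra_simps)
  qed
  then show ?thesis by blast
qed

text \<open>
  Compactness keeps \<open>f\<close> in a compact subinterval of the positive axis, where the power has a
  bounded derivative even if the exponent is below 1.
\<close>

lemma lipschitz_powr_compact:
  fixes f :: "'a::metric_space \<Rightarrow> real"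
  assumes X: "compact X" and f: "\<exists>L. L-lipschitz_on X f" and pos: "\<And>x. x \<in> X \<Longrightarrow> f x > 0"
  shows "\<exists>L. L-lipschitz_on X (\<lambda>x. f x powr \<alpha>)"
proof (cases "X = {}")
  case False
  obtain L where L: "L-lipschitz_on X f" using f by blast
  have cf: "compact (f ` X)"
    using X L by (auto intro!: compact_continuous_image lipschitz_on_continuous_on)
  obtain c where c: "c \<in> X" "\<And>x. x \<in> X \<Longrightarrow> f c \<le> f x"
    using compact_attains_inf[OF cf] False by auto
  obtain d where d: "d \<in> X" "\<And>x. x \<in> X \<Longrightarrow> f x \<le> f d"
    using compact_attains_sup[OF cf] False by auto
  define I where "I = {f c..f d}"
  have Ipos: "x > 0" if "x \<in> I" for x using that pos[OF c(1)] by (auto simp: I_def)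
  have "continuous_on I (\<lambda>x. \<alpha> * x powr (\<alpha> - 1))"
    using Ipos by (intro continuous_intros) force+
  then have "bounded ((\<lambda>x. \<alpha> * x powr (\<alpha> - 1)) ` I)"
    by (auto simp: I_def intro!: compact_imp_bounded compact_continuous_image)
  then obtain K where K: "\<And>x. x \<in> I \<Longrightarrow> norm (\<alpha> * x powr (\<alpha> - 1)) \<le> K"
    by (auto simp: bounded_iff)
  have "(\<bar>K\<bar> * L)-lipschitz_on X (\<lambda>x. f x powr \<alpha>)"
  proof (rule lipschitz_onI)
    show "0 \<le> \<bar>K\<bar> * L" using lipschitz_on_nonneg[OF L] by simp
    fix x y assume xy: "x \<in> X" "y \<in> X"
    have "norm (f x powr \<alpha> - f y powr \<alpha>) \<le> \<bar>K\<bar> * norm (f x - f y)"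
    proof (rule field_differentiable_bound[of I "\<lambda>x. x powr \<alpha>" "\<lambda>x. \<alpha> * x powr (\<alpha> - 1)"])
      show "convex I" by (simp add: I_def)
      show "((\<lambda>x. x powr \<alpha>) has_field_derivative \<alpha> * z powr (\<alpha> - 1)) (at z within I)"
        if "z \<in> I" for z
        using has_real_derivative_powr[OF Ipos[OF that], of \<alpha>] by (rule DERIV_subset) simp
      show "norm (\<alpha> * z powr (\<alpha> - 1)) \<le> \<bar>K\<bar>" if "z \<in> I" for z
        using K[OF that] by linarith
    qed (use xy c d in \<open>auto simp: I_def\<close>)
    also have "\<dots> \<le> \<bar>K\<bar> * (L * dist x y)"
      using lipschitz_onD[OF L xy] by (intro mult_left_mono) (auto simp: dist_real_def)
    finally show "dist (f x powr \<alpha>) (f y powr \<alpha>) \<le> \<bar>K\<bar> * L * dist x y"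
      by (simp add: dist_real_def mult.assoc)
  qed
  then show ?thesis by blast
qed (auto simp: lipschitz_on_def)

text \<open>
  The Picard operator is applied on the space of bounded continuous functions on the whole line,
  with time clamped to \<open>[0, T]\<close>; the bound on \<open>T\<close> makes it a contraction with factor one half.
\<close>

lemma picard_global:
  fixes f :: "'b::euclidean_space \<Rightarrow> 'b"
  assumes L: "L-lipschitz_on UNIV f" and T: "0 < T" "T * L \<le> 1/2"
  shows "\<exists>y. continuous_on UNIV y \<and> y 0 = y0 \<and>
           (\<forall>t. 0 < t \<and> t < T \<longrightarrow> (y has_vector_derivative f (y t)) (at t))"
proof -
  have cf: "continuous_on UNIV f" by (rule lipschitz_on_continuous_on[OF L])
  define P where "P = (\<lambda>(y::real \<Rightarrow> 'b) t. y0 + integral {0..t} (\<lambda>\<tau>. f (y \<tau>)))"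
  have cfy: "continuous_on S (\<lambda>t. f (apply_bcontfun y t))" for y :: "real \<Rightarrow>\<^sub>C 'b" and S
    by (rule continuous_on_compose2[OF cf]) auto
  have int: "(\<lambda>t. f (apply_bcontfun y t)) integrable_on {0..t}" for y :: "real \<Rightarrow>\<^sub>C 'b" and t
    by (rule integrable_continuous_real[OF cfy])
  have cP: "continuous_on {0..T} (P (apply_bcontfun y))" for y :: "real \<Rightarrow>\<^sub>C 'b"
    unfolding P_def by (intro continuous_intros indefinite_integral_continuous_1 int)
  have ex: "\<exists>z :: real \<Rightarrow>\<^sub>C 'b. \<forall>t. apply_bcontfun z t = P (apply_bcontfun y) (clamp 0 T t)"
    for y :: "real \<Rightarrow>\<^sub>C 'b"
    using continuous_on_cbox_bcontfunE[of 0 T "P (apply_bcontfun y)"] cP[of y]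
    by (metis box_real(2))
  define \<Phi> where "\<Phi> y = (SOME z :: real \<Rightarrow>\<^sub>C 'b.
      \<forall>t. apply_bcontfun z t = P (apply_bcontfun y) (clamp 0 T t))" for y
  have \<Phi>: "apply_bcontfun (\<Phi> y) t = P (apply_bcontfun y) (clamp 0 T t)" for y t
    unfolding \<Phi>_def using someI_ex[OF ex[of y]] by blast
  have cl: "0 \<le> clamp 0 T t \<and> clamp 0 T t \<le> T" for t :: real
    using clamp_in_interval[of 0 T t] T by auto
  have contr: "dist (\<Phi> y) (\<Phi> z) \<le> 1/2 * dist y z" for y z
  proof (rule dist_bound)
    fix t
    let ?s = "clamp 0 T t"
    have "norm (integral {0..?s} (\<lambda>\<tau>. f (apply_bcontfun y \<tau>) - f (apply_bcontfun z \<tau>)))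
          \<le> (L * dist y z) * (?s - 0)"
    proof (rule integral_bound)
      show "continuous_on {0..?s} (\<lambda>\<tau>. f (apply_bcontfun y \<tau>) - f (apply_bcontfun z \<tau>))"
        by (intro continuous_intros cfy)
      fix \<tau> :: real
      have "norm (f (apply_bcontfun y \<tau>) - f (apply_bcontfun z \<tau>))
            \<le> L * dist (apply_bcontfun y \<tau>) (apply_bcontfun z \<tau>)"
        using lipschitz_onD[OF L] by (simp add: dist_norm)
      also have "\<dots> \<le> L * dist y z"
        by (intro mult_left_mono dist_bounded lipschitz_on_nonneg[OF L])
      finally show "norm (f (apply_bcontfun y \<tau>) - f (apply_bcontfun z \<tau>)) \<le> L * dist y z" .
    qed (use cl in auto)
    also have "\<dots> \<le> (L * dist y z) * T"
      using cl[of t] lipschitz_on_nonneg[OF L] by (intro mult_left_mono) auto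
    also have "\<dots> = (T * L) * dist y z" by simp
    also have "\<dots> \<le> 1/2 * dist y z"
      using T by (intro mult_right_mono) auto
    finally show "dist (apply_bcontfun (\<Phi> y) t) (apply_bcontfun (\<Phi> z) t) \<le> 1/2 * dist y z"
      unfolding \<Phi> P_def by (simp add: dist_norm integral_diff[OF int int])
  qed
  obtain y where y: "\<Phi> y = y"
    using banach_fix_type[of "1/2" \<Phi>] contr by auto
  have eq: "apply_bcontfun y t = P (apply_bcontfun y) t" if "0 \<le> t" "t \<le> T" for t
    using \<Phi>[of y t] that by (simp add: y)
  have "(apply_bcontfun y has_vector_derivative f (apply_bcontfun y t)) (at t)"
    if t: "0 < t" "t < T" for t
  proof -
    have "((\<lambda>u. integral {0..u} (\<lambda>\<tau>. f (apply_bcontfun y \<tau>))) has_vector_derivative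
            f (apply_bcontfun y t)) (at t within {0..T})"
      by (rule integral_has_vector_derivative[OF cfy]) (use t in auto)
    then have "(P (apply_bcontfun y) has_vector_derivative f (apply_bcontfun y t))
                 (at t within {0..T})"
      unfolding P_def by (auto intro!: derivative_eq_intros)
    then have "(P (apply_bcontfun y) has_vector_derivative f (apply_bcontfun y t)) (at t)"
      using t by (simp add: at_within_Icc_at)
    then show ?thesis
      by (rule has_vector_derivative_transform_within_open[of _ _ _ "{0<..<T}"])
         (use t eq in auto)
  qed
  moreover have "apply_bcontfun y 0 = y0"
    using eq[of 0] T by (simp add: P_def)
  ultimately show ?thesis
    by (intro exI[of _ "apply_bcontfun y"]) auto
qed

text \<open>
  The solution of interest stays for a short time in a closed box around \<open>y0\<close> inside \<open>X\<close>.
  Composing the field with the projection onto this box makes it globally Lipschitz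
  without changing it on the box.
\<close>

lemma picard_local:
  fixes f :: "'b::euclidean_space \<Rightarrow> 'b"
  assumes X: "open X" "y0 \<in> X"
    and lip: "\<And>K. compact K \<Longrightarrow> K \<subseteq> X \<Longrightarrow> \<exists>L. L-lipschitz_on K f"
  shows "\<exists>y \<epsilon>. \<epsilon> > 0 \<and> continuous_on UNIV y \<and> y 0 = y0 \<and> (\<forall>t. 0 \<le> t \<and> t < \<epsilon> \<longrightarrow> y t \<in> X) \<and>
           (\<forall>t. 0 < t \<and> t < \<epsilon> \<longrightarrow> (y has_vector_derivative f (y t)) (at t))"
proof -
  obtain A B where AB: "cbox A B \<subseteq> X" "y0 \<in> box A B"
    using open_contains_cbox[OF X] by metis
  obtain L where L: "L-lipschitz_on (cbox A B) f"
    using lip[OF compact_cbox AB(1)] by blast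
  have ne: "cbox A B \<noteq> {}" using AB box_subset_cbox by blast
  have "L-lipschitz_on UNIV (\<lambda>x. f (clamp A B x))"
  proof (rule lipschitz_onI)
    fix x y
    have "dist (f (clamp A B x)) (f (clamp A B y)) \<le> L * dist (clamp A B x) (clamp A B y)"
      using ne by (intro lipschitz_onD[OF L] clamp_in_interval) (auto simp: box_ne_empty)
    also have "\<dots> \<le> L * dist x y"
      by (intro mult_left_mono dist_clamps_le_dist_args lipschitz_on_nonneg[OF L])
    finally show "dist (f (clamp A B x)) (f (clamp A B y)) \<le> L * dist x y" .
  qed (rule lipschitz_on_nonneg[OF L])
  moreover define T where "T = 1 / (2 * (L + 1))"
  have "T > 0" "T * L \<le> 1/2"
    using lipschitz_on_nonneg[OF L] by (auto simp: T_def field_simps)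
  ultimately obtain y where y: "continuous_on UNIV y" "y 0 = y0"
    "\<And>t. 0 < t \<Longrightarrow> t < T \<Longrightarrow> (y has_vector_derivative f (clamp A B (y t))) (at t)"
    using picard_global[of L "\<lambda>x. f (clamp A B x)" T y0] by blast
  have "open (y -` box A B)"
    by (rule open_vimage[OF open_box y(1)])
  moreover have "0 \<in> y -` box A B" using y AB by simp
  ultimately obtain d where d: "d > 0" "ball 0 d \<subseteq> y -` box A B"
    using open_contains_ball by blast
  have bx: "y t \<in> cbox A B" if "0 \<le> t" "t < min d T" for t
    using d(2) that box_subset_cbox[of A B] by (auto simp: subset_iff dist_real_def)
  have "(y has_vector_derivative f (y t)) (at t)" if "0 < t" "t < min d T" for t
    using y(3)[of t] bx[of t] that clamp_cancel_cbox[of "y t" A B] by auto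
  then show ?thesis
    using bx y(1,2) d(1) \<open>T > 0\<close> AB(1) by (intro exI[of _ y] exI[of _ "min d T"]) auto
qed

section \<open>Continuation past a positive endpoint\<close>

text \<open>
  A continuous function whose derivative extends continuously across a point is differentiable
  there. This removes the junction point when two solutions are joined.
\<close>

lemma has_real_derivative_at_removable:
  fixes f D :: "real \<Rightarrow> real"
  assumes f: "isCont f \<rho>" and D: "isCont D \<rho>"
    and der: "\<forall>\<^sub>F r in at \<rho>. (f has_real_derivative D r) (at r)"
  shows "(f has_real_derivative D \<rho>) (at \<rho>)"
  unfolding has_field_derivative_iff
proof (rule lhopital[where f' = D and g' = "\<lambda>_. 1"])
  show "((\<lambda>y. f y - f \<rho>) \<longlongrightarrow> 0) (at \<rho>)"
    using f by (simp add: isCont_def LIM_zero)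
  show "((\<lambda>y. y - \<rho>) \<longlongrightarrow> 0) (at \<rho>)"
    by (auto intro!: tendsto_eq_intros)
  show "\<forall>\<^sub>F y in at \<rho>. y - \<rho> \<noteq> 0"
    by (simp add: eventually_at_filter)
  show "\<forall>\<^sub>F y in at \<rho>. ((\<lambda>y. f y - f \<rho>) has_real_derivative D y) (at y)"
    using der by eventually_elim (auto intro!: derivative_eq_intros)
  show "\<forall>\<^sub>F y in at \<rho>. ((\<lambda>y. y - \<rho>) has_real_derivative 1) (at y)"
    by (intro always_eventually allI) (auto intro!: derivative_eq_intros)
  show "((\<lambda>y. D y / 1) \<longlongrightarrow> D \<rho>) (at \<rho>)"
    using D by (simp add: isCont_def)
qed simp

text \<open>
  The second piece \<open>k\<close> is parametrised by the time elapsed since the junction.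
\<close>

lemma glued_isCont:
  fixes g k :: "real \<Rightarrow> real"
  assumes g: "(g \<longlongrightarrow> k 0) (at_left \<rho>)" and k: "isCont k 0"
  shows "isCont (\<lambda>r. if r < \<rho> then g r else k (r - \<rho>)) \<rho>"
proof -
  have "((\<lambda>r. k (r - \<rho>)) \<longlongrightarrow> k 0) (at_right \<rho>)"
    by (rule isCont_tendsto_compose[OF k]) (auto intro!: tendsto_eq_intros)
  then have "((\<lambda>r. if r < \<rho> then g r else k (r - \<rho>)) \<longlongrightarrow> k 0) (at_right \<rho>)"
    by (rule Lim_transform_eventually)
       (auto simp: eventually_at_right_field intro!: exI[of _ "\<rho> + 1"])
  moreover have "((\<lambda>r. if r < \<rho> then g r else k (r - \<rho>)) \<longlongrightarrow> k 0) (at_left \<rho>)"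
    by (rule Lim_transform_eventually[OF g])
       (auto simp: eventually_at_left_field intro!: exI[of _ "\<rho> - 1"])
  ultimately show ?thesis
    unfolding isCont_def by (auto intro!: filterlim_split_at)
qed

lemma glued_deriv:
  fixes g k D :: "real \<Rightarrow> real" and \<rho> \<epsilon> :: real
  defines "f \<equiv> \<lambda>r. if r < \<rho> then g r else k (r - \<rho>)"
  assumes left: "\<And>r. 0 < r \<Longrightarrow> r < \<rho> \<Longrightarrow> (g has_real_derivative D r) (at r)"
    and right: "\<And>t. 0 < t \<Longrightarrow> t < \<epsilon> \<Longrightarrow> (k has_real_derivative D (\<rho> + t)) (at t)"
    and f: "isCont f \<rho>" and D: "isCont D \<rho>" and \<rho>: "0 < \<rho>" and \<epsilon>: "0 < \<epsilon>"
    and r: "0 < r" "r < \<rho> + \<epsilon>"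
  shows "(f has_real_derivative D r) (at r)"
proof -
  have off: "(f has_real_derivative D r) (at r)" if r: "0 < r" "r < \<rho> + \<epsilon>" "r \<noteq> \<rho>" for r
  proof (cases "r < \<rho>")
    case True
    then show ?thesis
      by (intro has_field_derivative_transform_within_open[OF left[OF r(1) True], of "{..<\<rho>}"])
         (auto simp: f_def)
  next
    case False
    have "(k has_real_derivative D r) (at (r + (- \<rho>)))"
      using right[of "r - \<rho>"] r False by simp
    then have "((\<lambda>r. k (r + (- \<rho>))) has_real_derivative D r) (at r)"
      by (simp only: DERIV_shift)
    then show ?thesis
      using False r
      by (intro has_field_derivative_transform_within_open[of _ _ _ "{\<rho><..}" f])
         (auto simp: f_def)
  qed
  show ?thesis
  proof (cases "r = \<rho>")
    case True
    have "\<forall>\<^sub>F r in at \<rho>. r \<in> {0<..<\<rho> + \<epsilon>} \<and> r \<noteq> \<rho>"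
      using \<rho> \<epsilon> by (intro eventually_conj eventually_at_in_open') (auto simp: eventually_at_filter)
    then have "\<forall>\<^sub>F r in at \<rho>. (f has_real_derivative D r) (at r)"
      by eventually_elim (use off in auto)
    from has_real_derivative_at_removable[OF f D this] show ?thesis using True by simp
  qed (use off r in auto)
qed

text \<open>
  The right-hand side of the coupled first-order system. The radius is carried along as the first
  coordinate, with speed 1, so that the system is autonomous and the Lipschitz condition on the
  field includes its continuity in \<open>r\<close>.
\<close>

definition radial_field ::
    "real \<Rightarrow> real \<Rightarrow> real \<Rightarrow> real \<Rightarrow> real \<Rightarrow> real \<Rightarrow> real \<Rightarrow> real \<Rightarrow> real
      \<Rightarrow> real \<times> real \<times> real \<times> real \<times> real \<Rightarrow> real \<times> real \<times> real \<times> real \<times> real" where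
  "radial_field n p q a b s m \<delta> \<mu> = (\<lambda>(r, u, v, F, G).
     (1, - ((F * r powr (1 - n)) powr (1 / (p - 1))), - ((G * r powr (1 - n)) powr (1 / (q - 1))),
      r powr (n - 1) * (r powr a * u powr s * v powr \<delta>),
      r powr (n - 1) * (r powr b * u powr \<mu> * v powr m)))"

text \<open>
  Each entry of the field is built from the coordinates by products and powers, and the
  coordinates are positive on the compact set.
\<close>

lemma radial_field_lipschitz:
  assumes K: "compact K" "K \<subseteq> {0<..} \<times> {0<..} \<times> {0<..} \<times> {0<..} \<times> {0<..}"
  shows "\<exists>L. L-lipschitz_on K (radial_field n p q a b s m \<delta> \<mu>)"
proof -
  have comp: "\<exists>L. L-lipschitz_on K (\<lambda>y. g (h y))"
    if h: "\<exists>L. L-lipschitz_on K h" and g: "\<And>x y. dist (g x) (g y) \<le> dist x y"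
    for h :: "real \<times> real \<times> real \<times> real \<times> real \<Rightarrow> 'x::metric_space"
      and g :: "'x \<Rightarrow> 'y::metric_space"
  proof -
    obtain L where L: "L-lipschitz_on K h" using h by blast
    have "L-lipschitz_on K (\<lambda>y. g (h y))"
      by (rule lipschitz_onI)
         (auto intro: order_trans[OF g lipschitz_onD[OF L]] lipschitz_on_nonneg[OF L])
    then show ?thesis by blast
  qed
  note fst_lip = comp[OF _ dist_fst_le] and snd_lip = comp[OF _ dist_snd_le]
  have Pair_lip: "\<exists>L. L-lipschitz_on K (\<lambda>y. (g y, h y))"
    if "\<exists>L. L-lipschitz_on K g" "\<exists>L. L-lipschitz_on K h"
    for g :: "real \<times> real \<times> real \<times> real \<times> real \<Rightarrow> 'x::metric_space" and h :: "_ \<Rightarrow> 'y::metric_space"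
    using that lipschitz_on_Pair by blast
  have minus_lip: "\<exists>L. L-lipschitz_on K (\<lambda>y. - g y)" if "\<exists>L. L-lipschitz_on K g"
    for g :: "real \<times> real \<times> real \<times> real \<times> real \<Rightarrow> real"
    using that by (simp add: lipschitz_on_minus_iff)
  have id_lip: "\<exists>L. L-lipschitz_on K (\<lambda>y. y)" and const_lip: "\<exists>L. L-lipschitz_on K (\<lambda>y. 1::real)"
    using lipschitz_on_id lipschitz_on_constant by blast+
  note r = fst_lip[OF id_lip] and r2 = snd_lip[OF id_lip]
  note u = fst_lip[OF r2] and r3 = snd_lip[OF r2]
  note v = fst_lip[OF r3] and r4 = snd_lip[OF r3]
  note F = fst_lip[OF r4] and G = snd_lip[OF r4]
  have pos: "fst y > 0" "fst (snd y) > 0" "fst (snd (snd y)) > 0"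
      "fst (snd (snd (snd y))) > 0" "snd (snd (snd (snd y))) > 0" if "y \<in> K" for y
    using subsetD[OF K(2) that] by (auto simp: mem_Times_iff)
  note mult = lipschitz_mult_compact[OF K(1)] and powr = lipschitz_powr_compact[OF K(1)]
  have rp: "\<exists>L. L-lipschitz_on K (\<lambda>y. fst y powr \<alpha>)"
    and up: "\<exists>L. L-lipschitz_on K (\<lambda>y. fst (snd y) powr \<alpha>)"
    and vp: "\<exists>L. L-lipschitz_on K (\<lambda>y. fst (snd (snd y)) powr \<alpha>)" for \<alpha>
    using pos by (auto intro!: powr r u v)
  have slopeF: "\<exists>L. L-lipschitz_on K (\<lambda>y. (fst (snd (snd (snd y))) * fst y powr \<beta>) powr \<alpha>)"
    and slopeG: "\<exists>L. L-lipschitz_on K (\<lambda>y. (snd (snd (snd (snd y))) * fst y powr \<beta>) powr \<alpha>)"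
    for \<alpha> \<beta>
  proof -
    have rpos: "fst y powr \<beta> > 0" if "y \<in> K" for y using pos(1)[OF that] by simp
    show "\<exists>L. L-lipschitz_on K (\<lambda>y. (fst (snd (snd (snd y))) * fst y powr \<beta>) powr \<alpha>)"
      by (rule powr[OF mult[OF F rp]], rule mult_pos_pos[OF pos(4) rpos])
    show "\<exists>L. L-lipschitz_on K (\<lambda>y. (snd (snd (snd (snd y))) * fst y powr \<beta>) powr \<alpha>)"
      by (rule powr[OF mult[OF G rp]], rule mult_pos_pos[OF pos(5) rpos])
  qed
  have "\<exists>L. L-lipschitz_on K (\<lambda>y. radial_field n p q a b s m \<delta> \<mu>
      (fst y, fst (snd y), fst (snd (snd y)), fst (snd (snd (snd y))), snd (snd (snd (snd y)))))"
    unfolding radial_field_def prod.case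
    by (intro Pair_lip minus_lip const_lip slopeF slopeG mult rp up vp)
  then show ?thesis by simp
qed

text \<open>
  The Picard solution starts from the left limits at \<open>\<rho>\<close>, so all four functions are continuous
  across \<open>\<rho>\<close> after joining. The right-hand sides depend only on these functions, hence are continuous
  too, and both the slope and the flux equations extend to the junction point.
\<close>

lemma radial_system_continuation:
  assumes \<rho>: "\<rho> > 0"
    and flux_u: "radial_flux n p \<rho> u F (\<lambda>r. r powr a * u r powr s * v r powr \<delta>)"
    and flux_v: "radial_flux n q \<rho> v G (\<lambda>r. r powr b * u r powr \<mu> * v r powr m)"
    and pos: "\<And>r. 0 < r \<Longrightarrow> r < \<rho> \<Longrightarrow> u r > 0 \<and> v r > 0"
    and lims: "(u \<longlongrightarrow> u1) (at_left \<rho>)" "(v \<longlongrightarrow> v1) (at_left \<rho>)"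
      "(F \<longlongrightarrow> F1) (at_left \<rho>)" "(G \<longlongrightarrow> G1) (at_left \<rho>)"
    and pos1: "u1 > 0" "v1 > 0" "F1 > 0" "G1 > 0"
  shows "\<exists>\<epsilon>>0. \<exists>U V FF GG. (\<forall>r<\<rho>. U r = u r \<and> V r = v r) \<and>
           (\<forall>r. 0 < r \<and> r < \<rho> + \<epsilon> \<longrightarrow> U r > 0 \<and> V r > 0) \<and>
           radial_flux n p (\<rho> + \<epsilon>) U FF (\<lambda>r. r powr a * U r powr s * V r powr \<delta>) \<and>
           radial_flux n q (\<rho> + \<epsilon>) V GG (\<lambda>r. r powr b * U r powr \<mu> * V r powr m)"
proof -
  let ?f = "radial_field n p q a b s m \<delta> \<mu>"
  let ?X = "{0<..} \<times> {0<..} \<times> {0<..} \<times> {0<..} \<times> {0<..} :: (real \<times> real \<times> real \<times> real \<times> real) set"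
  have "open ?X" by (intro open_Times open_greaterThan)
  moreover have "(\<rho>, u1, v1, F1, G1) \<in> ?X" using \<rho> pos1 by simp
  ultimately have "\<exists>y \<epsilon>. \<epsilon> > 0 \<and> continuous_on UNIV y \<and> y 0 = (\<rho>, u1, v1, F1, G1) \<and>
      (\<forall>t. 0 \<le> t \<and> t < \<epsilon> \<longrightarrow> y t \<in> ?X) \<and>
      (\<forall>t. 0 < t \<and> t < \<epsilon> \<longrightarrow> (y has_vector_derivative ?f (y t)) (at t))"
    by (rule picard_local) (rule radial_field_lipschitz)
  then obtain y \<epsilon> where \<epsilon>: "\<epsilon> > 0" and cy: "continuous_on UNIV y"
    and y0: "y 0 = (\<rho>, u1, v1, F1, G1)"
    and yX: "\<And>t. 0 \<le> t \<Longrightarrow> t < \<epsilon> \<Longrightarrow> y t \<in> ?X"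
    and dy: "\<And>t. 0 < t \<Longrightarrow> t < \<epsilon> \<Longrightarrow> (y has_vector_derivative ?f (y t)) (at t)"
    by (elim exE conjE) blast
  define T yu yv yF yG where "T = (\<lambda>t. fst (y t))" and "yu = (\<lambda>t. fst (snd (y t)))"
    and "yv = (\<lambda>t. fst (snd (snd (y t))))" and "yF = (\<lambda>t. fst (snd (snd (snd (y t)))))"
    and "yG = (\<lambda>t. snd (snd (snd (snd (y t)))))"
  have y_eq: "y t = (T t, yu t, yv t, yF t, yG t)" for t
    by (simp add: T_def yu_def yv_def yF_def yG_def)
  have ypos: "yu t > 0 \<and> yv t > 0 \<and> yF t > 0 \<and> yG t > 0" if "0 \<le> t" "t < \<epsilon>" for t
    using yX[OF that] by (simp add: y_eq)
  have cont: "continuous_on UNIV T" "continuous_on UNIV yu" "continuous_on UNIV yv"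
    "continuous_on UNIV yF" "continuous_on UNIV yG"
    unfolding T_def yu_def yv_def yF_def yG_def by (intro continuous_intros cy)+
  have init: "T 0 = \<rho>" "yu 0 = u1" "yv 0 = v1" "yF 0 = F1" "yG 0 = G1"
    using y0 by (simp_all add: y_eq)
  have dT: "(T has_real_derivative 1) (at t)"
    and dyu: "(yu has_real_derivative - ((yF t * T t powr (1 - n)) powr (1 / (p - 1)))) (at t)"
    and dyv: "(yv has_real_derivative - ((yG t * T t powr (1 - n)) powr (1 / (q - 1)))) (at t)"
    and dyF: "(yF has_real_derivative
        T t powr (n - 1) * (T t powr a * yu t powr s * yv t powr \<delta>)) (at t)"
    and dyG: "(yG has_real_derivative
        T t powr (n - 1) * (T t powr b * yu t powr \<mu> * yv t powr m)) (at t)"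
    if t: "0 < t" "t < \<epsilon>" for t
  proof -
    note S = bounded_linear.has_vector_derivative[OF bounded_linear_snd]
    note F = bounded_linear.has_vector_derivative[OF bounded_linear_fst]
    have d0: "(y has_vector_derivative ?f (T t, yu t, yv t, yF t, yG t)) (at t)"
      using dy[OF t] by (simp add: y_eq)
    note d = d0[unfolded radial_field_def prod.case]
    show "(T has_real_derivative 1) (at t)"
      using F[OF d] by (simp add: T_def has_real_derivative_iff_has_vector_derivative)
    show "(yu has_real_derivative - ((yF t * T t powr (1 - n)) powr (1 / (p - 1)))) (at t)"
      using F[OF S[OF d]] by (simp add: yu_def has_real_derivative_iff_has_vector_derivative)
    show "(yv has_real_derivative - ((yG t * T t powr (1 - n)) powr (1 / (q - 1)))) (at t)"
      using F[OF S[OF S[OF d]]] by (simp add: yv_def has_real_derivative_iff_has_vector_derivative)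
    show "(yF has_real_derivative
        T t powr (n - 1) * (T t powr a * yu t powr s * yv t powr \<delta>)) (at t)"
      using F[OF S[OF S[OF S[OF d]]]]
      by (simp add: yF_def has_real_derivative_iff_has_vector_derivative)
    show "(yG has_real_derivative
        T t powr (n - 1) * (T t powr b * yu t powr \<mu> * yv t powr m)) (at t)"
      using S[OF S[OF S[OF S[OF d]]]]
      by (simp add: yG_def has_real_derivative_iff_has_vector_derivative)
  qed
  \<comment> \<open>The first coordinate is the radius, so the other coordinates solve the original
      nonautonomous system.\<close>
  have T_eq: "T t = \<rho> + t" if t: "0 < t" "t < \<epsilon>" for t
  proof -
    have "T t - t = T 0 - 0"
    proof (rule DERIV_isconst_end[OF t(1)])
      show "continuous_on {0..t} (\<lambda>x. T x - x)"
        by (intro continuous_intros continuous_on_subset[OF cont(1)]) simp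
      show "((\<lambda>x. T x - x) has_real_derivative 0) (at x)" if "0 < x" "x < t" for x
        using DERIV_diff[OF dT[of x] DERIV_ident] that t by simp
    qed
    then show ?thesis using init by simp
  qed
  define U V FF GG where "U = (\<lambda>r. if r < \<rho> then u r else yu (r - \<rho>))"
    and "V = (\<lambda>r. if r < \<rho> then v r else yv (r - \<rho>))"
    and "FF = (\<lambda>r. if r < \<rho> then F r else yF (r - \<rho>))"
    and "GG = (\<lambda>r. if r < \<rho> then G r else yG (r - \<rho>))"
  have c\<rho>: "isCont U \<rho>" "isCont V \<rho>" "isCont FF \<rho>" "isCont GG \<rho>"
    unfolding U_def V_def FF_def GG_def
    by (intro glued_isCont; use lims init cont in \<open>simp add: continuous_on_eq_continuous_at\<close>)+
  have Upos: "U r > 0" and Vpos: "V r > 0" and Fpos: "FF r > 0" and Gpos: "GG r > 0"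
    if "0 < r" "r < \<rho> + \<epsilon>" for r
    using that pos[of r] ypos[of "r - \<rho>"] flux_u flux_v
    by (auto simp: U_def V_def FF_def GG_def radial_flux_def)
  have \<rho>2: "\<rho> < \<rho> + \<epsilon>" using \<epsilon> by simp
  note nz = \<rho> Upos[OF \<rho> \<rho>2] Vpos[OF \<rho> \<rho>2] Fpos[OF \<rho> \<rho>2] Gpos[OF \<rho> \<rho>2]
  have sh: "U (\<rho> + t) = yu t" "V (\<rho> + t) = yv t" "FF (\<rho> + t) = yF t" "GG (\<rho> + t) = yG t"
    if "0 < t" for t
    using that by (simp_all add: U_def V_def FF_def GG_def)
  have dU: "(U has_real_derivative - ((FF r * r powr (1 - n)) powr (1 / (p - 1)))) (at r)"
    if r: "0 < r" "r < \<rho> + \<epsilon>" for r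
    unfolding U_def
  proof (rule glued_deriv[where D = "\<lambda>r. - ((FF r * r powr (1 - n)) powr (1 / (p - 1)))"])
    show "(u has_real_derivative - ((FF r * r powr (1 - n)) powr (1 / (p - 1)))) (at r)"
      if "0 < r" "r < \<rho>" for r
      using flux_u that by (simp add: radial_flux_def FF_def)
    show "(yu has_real_derivative - ((FF (\<rho> + t) * (\<rho> + t) powr (1 - n)) powr (1 / (p - 1)))) (at t)"
      if "0 < t" "t < \<epsilon>" for t
      using dyu[OF that] T_eq[OF that] sh[OF that(1)] by simp
    show "isCont (\<lambda>r. - ((FF r * r powr (1 - n)) powr (1 / (p - 1)))) \<rho>"
      using nz by (intro continuous_intros c\<rho>) auto
  qed (use c\<rho>(1) \<rho> \<epsilon> r in \<open>auto simp: U_def\<close>)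
  have dV: "(V has_real_derivative - ((GG r * r powr (1 - n)) powr (1 / (q - 1)))) (at r)"
    if r: "0 < r" "r < \<rho> + \<epsilon>" for r
    unfolding V_def
  proof (rule glued_deriv[where D = "\<lambda>r. - ((GG r * r powr (1 - n)) powr (1 / (q - 1)))"])
    show "(v has_real_derivative - ((GG r * r powr (1 - n)) powr (1 / (q - 1)))) (at r)"
      if "0 < r" "r < \<rho>" for r
      using flux_v that by (simp add: radial_flux_def GG_def)
    show "(yv has_real_derivative - ((GG (\<rho> + t) * (\<rho> + t) powr (1 - n)) powr (1 / (q - 1)))) (at t)"
      if "0 < t" "t < \<epsilon>" for t
      using dyv[OF that] T_eq[OF that] sh[OF that(1)] by simp
    show "isCont (\<lambda>r. - ((GG r * r powr (1 - n)) powr (1 / (q - 1)))) \<rho>"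
      using nz by (intro continuous_intros c\<rho>) auto
  qed (use c\<rho>(2) \<rho> \<epsilon> r in \<open>auto simp: V_def\<close>)
  have dFF: "(FF has_real_derivative r powr (n - 1) * (r powr a * U r powr s * V r powr \<delta>)) (at r)"
    if r: "0 < r" "r < \<rho> + \<epsilon>" for r
    unfolding FF_def
  proof (rule glued_deriv[where D = "\<lambda>r. r powr (n - 1) * (r powr a * U r powr s * V r powr \<delta>)"])
    show "(F has_real_derivative r powr (n - 1) * (r powr a * U r powr s * V r powr \<delta>)) (at r)"
      if "0 < r" "r < \<rho>" for r
      using flux_u that by (simp add: radial_flux_def U_def V_def)
    show "(yF has_real_derivative (\<rho> + t) powr (n - 1) *
        ((\<rho> + t) powr a * U (\<rho> + t) powr s * V (\<rho> + t) powr \<delta>)) (at t)"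
      if "0 < t" "t < \<epsilon>" for t
      using dyF[OF that] T_eq[OF that] sh[OF that(1)] by simp
    show "isCont (\<lambda>r. r powr (n - 1) * (r powr a * U r powr s * V r powr \<delta>)) \<rho>"
      using nz by (intro continuous_intros c\<rho>) auto
  qed (use c\<rho>(3) \<rho> \<epsilon> r in \<open>auto simp: FF_def\<close>)
  have dGG: "(GG has_real_derivative r powr (n - 1) * (r powr b * U r powr \<mu> * V r powr m)) (at r)"
    if r: "0 < r" "r < \<rho> + \<epsilon>" for r
    unfolding GG_def
  proof (rule glued_deriv[where D = "\<lambda>r. r powr (n - 1) * (r powr b * U r powr \<mu> * V r powr m)"])
    show "(G has_real_derivative r powr (n - 1) * (r powr b * U r powr \<mu> * V r powr m)) (at r)"
      if "0 < r" "r < \<rho>" for r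
      using flux_v that by (simp add: radial_flux_def U_def V_def)
    show "(yG has_real_derivative (\<rho> + t) powr (n - 1) *
        ((\<rho> + t) powr b * U (\<rho> + t) powr \<mu> * V (\<rho> + t) powr m)) (at t)"
      if "0 < t" "t < \<epsilon>" for t
      using dyG[OF that] T_eq[OF that] sh[OF that(1)] by simp
    show "isCont (\<lambda>r. r powr (n - 1) * (r powr b * U r powr \<mu> * V r powr m)) \<rho>"
      using nz by (intro continuous_intros c\<rho>) auto
  qed (use c\<rho>(4) \<rho> \<epsilon> r in \<open>auto simp: GG_def\<close>)
  have "radial_flux n p (\<rho> + \<epsilon>) U FF (\<lambda>r. r powr a * U r powr s * V r powr \<delta>)"
    unfolding radial_flux_def by (intro allI impI conjI; elim conjE) (rule Fpos dU dFF; assumption)+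
  moreover have "radial_flux n q (\<rho> + \<epsilon>) V GG (\<lambda>r. r powr b * U r powr \<mu> * V r powr m)"
    unfolding radial_flux_def by (intro allI impI conjI; elim conjE) (rule Gpos dV dGG; assumption)+
  moreover have "\<forall>r<\<rho>. U r = u r \<and> V r = v r" by (simp add: U_def V_def)
  moreover have "\<forall>r. 0 < r \<and> r < \<rho> + \<epsilon> \<longrightarrow> U r > 0 \<and> V r > 0" using Upos Vpos by simp
  ultimately show ?thesis using \<epsilon> by (intro exI[of _ \<epsilon>] conjI exI[of _ U] exI[of _ V] exI[of _ FF] exI[of _ GG])
qed

section \<open>Maximal solutions are global\<close>

lemma increasing_bounded_left_limit:
  fixes f :: "real \<Rightarrow> real"
  assumes \<rho>: "0 < \<rho>" and inc: "\<And>x y. 0 < x \<Longrightarrow> x < y \<Longrightarrow> y < \<rho> \<Longrightarrow> f x \<le> f y"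
    and bnd: "\<And>x. 0 < x \<Longrightarrow> x < \<rho> \<Longrightarrow> f x \<le> K"
  shows "\<exists>l. (f \<longlongrightarrow> l) (at_left \<rho>)"
proof -
  have "(f \<longlongrightarrow> Sup (f ` ({..<\<rho>} \<inter> {0<..<\<rho>}))) (at \<rho> within ({..<\<rho>} \<inter> {0<..<\<rho>}))"
  proof (rule Lim_left_bound)
    show "f a \<le> f b" if "a \<in> {0<..<\<rho>}" "b \<in> {0<..<\<rho>}" "b < \<rho>" "a \<le> b" for a b
      using inc[of a b] that by (cases "a = b") auto
  qed (use bnd in auto)
  moreover have "at \<rho> within ({..<\<rho>} \<inter> {0<..<\<rho>}) = at_left \<rho>"
    using \<rho> by (intro at_within_nhd[of _ "{0<..}"]) auto
  ultimately show ?thesis by auto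
qed

lemma positive_left_limit:
  fixes f :: "real \<Rightarrow> real"
  assumes \<rho>: "0 < \<rho>" and lim: "(f \<longlongrightarrow> l) (at_left \<rho>)" and c: "c > 0" "0 \<le> r0" "r0 < \<rho>"
    and bnd: "\<And>r. r0 < r \<Longrightarrow> r < \<rho> \<Longrightarrow> c \<le> f r"
  shows "l > 0"
proof -
  have "\<forall>\<^sub>F r in at_left \<rho>. c \<le> f r"
    using c bnd by (auto simp: eventually_at_left_field intro!: exI[of _ r0])
  then have "c \<le> l"
    by (intro tendsto_lowerbound[OF lim]) auto
  then show ?thesis using c by linarith
qed

text \<open>
  Adding 1 to the bound on \<open>s\<close> gives the Hardy-Sobolev exponent \<open>p (N + a) / (N - p)\<close>, the
  form in which it appears in the derivative of the energy.
\<close>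

lemma critical_exponent:
  fixes N p a s :: real
  assumes "1 < p" "p < N" "p + a > 0" and "s \<ge> (N * (p - 1) + p + p * a) / (N - p)"
  shows "s + 1 \<ge> p * (N + a) / (N - p)" and "N + a > 0"
proof -
  have "(N * (p - 1) + p + p * a) / (N - p) + 1 = p * (N + a) / (N - p)"
    using assms by (simp add: field_simps)
  then show "s + 1 \<ge> p * (N + a) / (N - p)" using assms(4) by linarith
qed (use assms in linarith)

text \<open>
  The coupling enters only through \<open>V = v\<^sup>\<delta>\<close>: a positive decreasing weight with a limit at the
  origin. The second equation therefore contributes nothing but the monotonicity of \<open>v\<close>.
\<close>

lemma system_lower_bound:
  assumes p: "1 < p" "p < n" and \<rho>: "\<rho> > 0" and pa: "p + a > 0" and s: "s \<ge> 0" and \<delta>: "\<delta> > 0"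
    and crit: "s \<ge> (n * (p - 1) + p + p * a) / (n - p)"
    and flux_u: "radial_flux n p \<rho> u F (\<lambda>r. r powr a * u r powr s * v r powr \<delta>)"
    and flux_v: "radial_flux n q \<rho> v G h"
    and pos: "\<And>r. 0 < r \<Longrightarrow> r < \<rho> \<Longrightarrow> u r > 0 \<and> v r > 0"
    and u0: "(u \<longlongrightarrow> u0) (at_right 0)" and v0: "(v \<longlongrightarrow> v0) (at_right 0)"
  shows "\<exists>c>0. \<forall>r. 0 < r \<and> r < \<rho> \<longrightarrow> c \<le> u r"
    and "\<exists>M>0. \<forall>r. 0 < r \<and> r < \<rho> \<longrightarrow> F r \<le> M"
proof -
  define V' where "V' = (\<lambda>r. \<delta> * v r powr (\<delta> - 1) * - ((G r * r powr (1 - n)) powr (1 / (q - 1))))"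
  have dV: "((\<lambda>r. v r powr \<delta>) has_real_derivative V' r) (at r) \<and> V' r < 0"
    if r: "0 < r" "r < \<rho>" for r
  proof
    have dv: "(v has_real_derivative - ((G r * r powr (1 - n)) powr (1 / (q - 1)))) (at r)"
      and G: "G r > 0" using flux_v r by (auto simp: radial_flux_def)
    have v: "v r > 0" using pos r by blast
    show "((\<lambda>r. v r powr \<delta>) has_real_derivative V' r) (at r)"
      unfolding V'_def using DERIV_fun_powr[OF dv v, of \<delta>] by simp
    show "V' r < 0" unfolding V'_def using \<delta> v G r by (simp add: mult_pos_neg)
  qed
  have V0: "((\<lambda>r. v r powr \<delta>) \<longlongrightarrow> v0 powr \<delta>) (at_right 0)"
  proof (rule tendsto_powr'[OF v0 tendsto_const], intro disjI2 conjI \<delta>)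
    have "\<forall>\<^sub>F t in at_right 0. 0 < t \<and> t < \<rho>"
      using \<rho> by (auto simp: eventually_at_right_field intro!: exI[of _ "\<rho>"])
    then show "\<forall>\<^sub>F t in at_right 0. 0 \<le> v t"
      by eventually_elim (use pos in \<open>auto intro: less_imp_le\<close>)
  qed
  have Vpos: "v r powr \<delta> > 0" if "0 < r" "r < \<rho>" for r
    using pos[OF that] by simp
  have upos: "u r > 0" if "0 < r" "r < \<rho>" for r
    using pos[OF that] by simp
  show "\<exists>c>0. \<forall>r. 0 < r \<and> r < \<rho> \<longrightarrow> c \<le> u r"
    by (rule pohozaev_lower_bound[OF p \<rho> critical_exponent(2)[OF p pa crit] s
          critical_exponent(1)[OF p pa crit] flux_u upos Vpos dV u0 V0])
  have Vdec: "v y powr \<delta> \<le> v x powr \<delta>" if "0 < x" "x < y" "y < \<rho>" for x y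
    using radial_flux_strictly_decreasing[OF flux_v that] pos[of y] that \<delta>
    by (intro powr_mono2) auto
  show "\<exists>M>0. \<forall>r. 0 < r \<and> r < \<rho> \<longrightarrow> F r \<le> M"
    by (rule radial_flux_bounded[OF flux_u s \<rho> upos Vpos Vdec])
qed

lemma radial_flux_endpoint:
  assumes \<rho>: "\<rho> > 0" and flux: "radial_flux n p \<rho> u F h"
    and h: "\<And>r. 0 < r \<Longrightarrow> r < \<rho> \<Longrightarrow> h r > 0"
    and lower: "\<exists>c>0. \<forall>r. 0 < r \<and> r < \<rho> \<longrightarrow> c \<le> u r"
    and upper: "\<exists>M>0. \<forall>r. 0 < r \<and> r < \<rho> \<longrightarrow> F r \<le> M"
  shows "\<exists>u1 F1. u1 > 0 \<and> F1 > 0 \<and> (u \<longlongrightarrow> u1) (at_left \<rho>) \<and> (F \<longlongrightarrow> F1) (at_left \<rho>)"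
proof -
  obtain c where c: "c > 0" "\<And>r. 0 < r \<Longrightarrow> r < \<rho> \<Longrightarrow> c \<le> u r" using lower by blast
  obtain M where M: "\<And>r. 0 < r \<Longrightarrow> r < \<rho> \<Longrightarrow> F r \<le> M" using upper by blast
  have "\<exists>l. ((\<lambda>r. - u r) \<longlongrightarrow> l) (at_left \<rho>)"
    by (rule increasing_bounded_left_limit[OF \<rho>, of _ "- c"])
       (use radial_flux_strictly_decreasing[OF flux] c in \<open>auto intro: less_imp_le\<close>)
  then obtain u1 where u1: "(u \<longlongrightarrow> u1) (at_left \<rho>)"
    using tendsto_minus_cancel_left by (metis minus_minus)
  have inc: "F x < F y" if "0 < x" "x < y" "y < \<rho>" for x y
    by (rule radial_flux_strictly_increasing[OF flux h that])
  obtain F1 where F1: "(F \<longlongrightarrow> F1) (at_left \<rho>)"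
    using increasing_bounded_left_limit[OF \<rho>, of F M] inc M less_imp_le by blast
  have "u1 > 0"
    by (rule positive_left_limit[OF \<rho> u1 c(1) order_refl \<rho>]) (use c in auto)
  moreover have "F1 > 0"
  proof (rule positive_left_limit[OF \<rho> F1])
    show "F (\<rho> / 2) > 0" using flux \<rho> by (simp add: radial_flux_def)
    show "F (\<rho> / 2) \<le> F r" if "\<rho> / 2 < r" "r < \<rho>" for r using inc[of "\<rho>/2" r] that \<rho> by simp
  qed (use \<rho> in auto)
  ultimately show ?thesis using u1 F1 by blast
qed

lemma regular_radial_solution_if_radial_flux:
  assumes n: "n = real DIM('a::euclidean_space)" and p: "1 < p" and q: "1 < q" and \<rho>: "\<rho> > 0"
    and flux_u: "radial_flux n p \<rho> u F (\<lambda>r. r powr a * u r powr s * v r powr \<delta>)"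
    and flux_v: "radial_flux n q \<rho> v G (\<lambda>r. r powr b * u r powr \<mu> * v r powr m)"
    and pos: "\<And>r. 0 < r \<Longrightarrow> r < \<rho> \<Longrightarrow> u r > 0 \<and> v r > 0"
    and u0: "(u \<longlongrightarrow> u 0) (at_right 0)" and v0: "(v \<longlongrightarrow> v 0) (at_right 0)"
  shows "regular_radial_solution TYPE('a) p q a b s m \<delta> \<mu> (ereal \<rho>) u v"
proof -
  have cont: "continuous_on {0<..<\<rho>} w" if "radial_flux n p' \<rho> w H h" for w H h p'
    by (rule DERIV_continuous_on[OF has_field_derivative_at_within])
       (use that in \<open>auto simp: radial_flux_def\<close>)
  have cont0: "continuous_on {r. 0 \<le> r \<and> ereal r < ereal \<rho>} w"
    if flux: "radial_flux n p' \<rho> w H h" and w0: "(w \<longlongrightarrow> w 0) (at_right 0)" for w H h p'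
    unfolding continuous_on_eq_continuous_within
  proof
    fix r assume "r \<in> {r. 0 \<le> r \<and> ereal r < ereal \<rho>}"
    then consider "r = 0" | "r \<in> {0<..<\<rho>}" by fastforce
    then show "continuous (at r within {r. 0 \<le> r \<and> ereal r < ereal \<rho>}) w"
    proof cases
      case 1
      have "(w \<longlongrightarrow> w 0) (at 0 within {0..})"
        using w0 by (simp add: at_within_Ici_at_right)
      then show ?thesis
        using 1 by (auto simp: continuous_within intro: tendsto_within_subset)
    next
      case 2
      then show ?thesis
        using cont[OF flux] continuous_on_eq_continuous_at[of "{0<..<\<rho>}" w]
        by (auto intro: continuous_at_imp_continuous_at_within)
    qed
  qed
  have nz: "u r \<noteq> 0" "v r \<noteq> 0" if "r \<in> {0<..<\<rho>}" for r using pos[of r] that by auto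
  have "C2_on {r. 0 < r \<and> ereal r < ereal \<rho>} u"
    by (rule C2_if_radial_flux[OF flux_u])
       (auto intro!: continuous_intros cont[OF flux_u] cont[OF flux_v] simp: nz)
  moreover have "C2_on {r. 0 < r \<and> ereal r < ereal \<rho>} v"
    by (rule C2_if_radial_flux[OF flux_v])
       (auto intro!: continuous_intros cont[OF flux_u] cont[OF flux_v] simp: nz)
  ultimately show ?thesis
    unfolding regular_radial_solution_def positive_radial_solution_def
    using \<rho> pos cont0[OF flux_u u0] cont0[OF flux_v v0]
      p_laplacian_if_radial_flux[OF n p flux_u] p_laplacian_if_radial_flux[OF n q flux_v]
    by auto
qed

theorem proposition1p2:
  fixes N p q a b s m \<delta> \<mu> :: real
    and R :: ereal and u v :: "real \<Rightarrow> real"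
  assumes "N = real DIM('a::euclidean_space)"
    and "1 < p" "p < N" "1 < q" "q < N"
    and "min (p + a) (q + b) > 0"
    and "s \<ge> 0" "m \<ge> 0" "\<delta> > 0" "\<mu> > 0"
    and "\<delta> * \<mu> - (p - 1 - s) * (q - 1 - m) > 0"
    and "s \<ge> (N * (p - 1) + p + p * a) / (N - p)"
    and "m \<ge> (N * (q - 1) + q + q * b) / (N - q)"
    and "maximal_regular_radial_solution TYPE('a) p q a b s m \<delta> \<mu> R u v"
  shows "R = \<infinity> \<and> ground_state TYPE('a) p q a b s m \<delta> \<mu> u v"
proof -
  note N = assms(1) and p = assms(2,3) and q = assms(4,5)
  have pa: "p + a > 0" and qb: "q + b > 0" using assms(6) by auto
  have reg: "regular_radial_solution TYPE('a) p q a b s m \<delta> \<mu> R u v"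
    and max: "\<not> (\<exists>R' u1 v1. R < R' \<and> regular_radial_solution TYPE('a) p q a b s m \<delta> \<mu> R' u1 v1 \<and>
          (\<forall>r\<ge>0. ereal r < R \<longrightarrow> u1 r = u r \<and> v1 r = v r))"
    using assms(14) by (auto simp: maximal_regular_radial_solution_def)
  have "R = \<infinity>"
  proof (rule ccontr)
    assume "R \<noteq> \<infinity>"
    moreover have "R > 0" using reg by (simp add: regular_radial_solution_def)
    ultimately obtain \<rho> where R: "R = ereal \<rho>" and \<rho>: "\<rho> > 0" by (cases R) auto
    have pos: "u r > 0 \<and> v r > 0" if "0 < r" "r < \<rho>" for r
      using reg that by (simp add: R regular_radial_solution_def positive_radial_solution_def)
    have at0: "(w \<longlongrightarrow> w 0) (at_right 0)"
      if "continuous_on {r. 0 \<le> r \<and> ereal r < ereal \<rho>} w" for w :: "real \<Rightarrow> real"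
    proof -
      have "(w \<longlongrightarrow> w 0) (at 0 within {r. 0 \<le> r \<and> ereal r < ereal \<rho>})"
        using that \<rho> by (simp add: continuous_on_def)
      then have "(w \<longlongrightarrow> w 0) (at 0 within {0<..<\<rho>})"
        by (rule tendsto_within_subset) auto
      moreover have "at 0 within {0<..<\<rho>} = at_right 0"
        using \<rho> by (intro at_within_nhd[of _ "{..<\<rho>}"]) auto
      ultimately show ?thesis by simp
    qed
    have u0: "(u \<longlongrightarrow> u 0) (at_right 0)" and v0: "(v \<longlongrightarrow> v 0) (at_right 0)"
      using reg by (auto simp: R regular_radial_solution_def intro!: at0)
    obtain u' v' where
      du: "\<And>r. 0 < r \<Longrightarrow> r < \<rho> \<Longrightarrow> (u has_real_derivative u' r) (at r)" and
      dv: "\<And>r. 0 < r \<Longrightarrow> r < \<rho> \<Longrightarrow> (v has_real_derivative v' r) (at r)"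
      using reg by (auto simp: R regular_radial_solution_def C2_on_def)
    let ?h = "\<lambda>r. r powr a * u r powr s * v r powr \<delta>"
    let ?k = "\<lambda>r. r powr b * u r powr \<mu> * v r powr m"
    have hpos: "?h r > 0" and kpos: "?k r > 0" if "0 < r" "r < \<rho>" for r
      using pos[OF that] that by simp_all
    have "\<exists>F. radial_flux N p \<rho> u F ?h"
    proof (rule radial_flux_if_p_laplacian[OF N p du _ hpos u0])
      show "has_p_laplacian p (\<lambda>y. u (norm y)) (- ?h (norm x)) x"
        if "x \<noteq> 0" "norm x < \<rho>" for x :: 'a
        using reg that by (simp add: R regular_radial_solution_def positive_radial_solution_def)
    qed
    then obtain F where flux_u: "radial_flux N p \<rho> u F ?h" by blast
    have "\<exists>G. radial_flux N q \<rho> v G ?k"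
    proof (rule radial_flux_if_p_laplacian[OF N q dv _ kpos v0])
      show "has_p_laplacian q (\<lambda>y. v (norm y)) (- ?k (norm x)) x"
        if "x \<noteq> 0" "norm x < \<rho>" for x :: 'a
        using reg that by (simp add: R regular_radial_solution_def positive_radial_solution_def)
    qed
    then obtain G where flux_v: "radial_flux N q \<rho> v G ?k" by blast
    \<comment> \<open>The second equation in the form in which \<open>v\<close> is the unknown and \<open>u\<close> the weight.\<close>
    have flux_v': "radial_flux N q \<rho> v G (\<lambda>r. r powr b * v r powr m * u r powr \<mu>)"
      using flux_v by (simp add: mult_ac)
    obtain u1 F1 where u1: "u1 > 0" "F1 > 0" "(u \<longlongrightarrow> u1) (at_left \<rho>)" "(F \<longlongrightarrow> F1) (at_left \<rho>)"
      using radial_flux_endpoint[OF \<rho> flux_u hpos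
          system_lower_bound[OF p \<rho> pa assms(7,9,12) flux_u flux_v pos u0 v0]] by blast
    have pos': "v r > 0 \<and> u r > 0" if "0 < r" "r < \<rho>" for r using pos[OF that] by simp
    obtain v1 G1 where v1: "v1 > 0" "G1 > 0" "(v \<longlongrightarrow> v1) (at_left \<rho>)" "(G \<longlongrightarrow> G1) (at_left \<rho>)"
      using radial_flux_endpoint[OF \<rho> flux_v kpos
          system_lower_bound[OF q \<rho> qb assms(8,10,13) flux_v' flux_u pos' v0 u0]] by blast
    obtain \<epsilon> U V FF GG where \<epsilon>: "\<epsilon> > 0" and eq: "\<And>r. r < \<rho> \<Longrightarrow> U r = u r \<and> V r = v r"
      and UV: "\<And>r. 0 < r \<Longrightarrow> r < \<rho> + \<epsilon> \<Longrightarrow> U r > 0 \<and> V r > 0"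
      and fU: "radial_flux N p (\<rho> + \<epsilon>) U FF (\<lambda>r. r powr a * U r powr s * V r powr \<delta>)"
      and fV: "radial_flux N q (\<rho> + \<epsilon>) V GG (\<lambda>r. r powr b * U r powr \<mu> * V r powr m)"
      using radial_system_continuation[OF \<rho> flux_u flux_v pos u1(3) v1(3) u1(4) v1(4)
          u1(1) v1(1) u1(2) v1(2)] by blast
    have ev: "\<forall>\<^sub>F r in at_right 0. r < \<rho>"
      using \<rho> by (auto simp: eventually_at_right_field)
    have U0: "(U \<longlongrightarrow> U 0) (at_right 0)" and V0: "(V \<longlongrightarrow> V 0) (at_right 0)"
      using eq \<rho> by (auto intro!: Lim_transform_eventually[OF u0] Lim_transform_eventually[OF v0]
          eventually_mono[OF ev])
    have "regular_radial_solution TYPE('a) p q a b s m \<delta> \<mu> (ereal (\<rho> + \<epsilon>)) U V"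
      by (rule regular_radial_solution_if_radial_flux[OF N p(1) q(1) _ fU fV UV U0 V0])
         (use \<rho> \<epsilon> in auto)
    moreover have "R < ereal (\<rho> + \<epsilon>)" using R \<epsilon> by simp
    moreover have "\<forall>r\<ge>0. ereal r < R \<longrightarrow> U r = u r \<and> V r = v r" using eq R by simp
    ultimately show False using max by blast
  qed
  then show ?thesis using reg by (simp add: ground_state_def)
qed

end
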